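(* Consider the control system for $w(x,t)$, $x\in[0,l]$, $t\ge 0$, with inputs $u_0,\dots,u_k$ and outputs $y_1,\dots,y_p$, given by $$\ddot w(x,t)+\frac{EI}{\rho}w''''(x,t)+d\,\dot w''''(x,t)=\frac1\rho\sum_{j=1}^k\psi_j''(x)u_j(t),\qquad x\in[0,l_0)\cup(l_0,l],$$ $$(m\ddot w+\varkappa w)\big|_{x=l_0}=(EIw'')'\big|_{x=l_0-0}-(EIw'')'\big|_{x=l_0+0}+u_0(t),$$ $$w|_{x=0}=w|_{x=l}=0,\qquad w''|_{x=0}=w''|_{x=l}=0,$$ $$y_i(t)=\frac{\partial^2 w(x,t)}{\partial x^2}\Big|_{x=l_i},\qquad i=1,\dots,p,$$ with $w(\cdot,t)$ of class $C^2[0,l]$ and zero initial data. Its transfer function, i.e. the $p\times(k+1)$ matrix $H(s)$ with $(Y_1(s),\dots,Y_p(s))^T=H(s)\,(U_0(s),U_1(s),\dots,U_k(s))^T$, is $$H(s)=\begin{pmatrix} h_0^s(l_1)&h_1^s(l_1)&\cdots&h_k^s(l_1)\\ h_0^s(l_2)&h_1^s(l_2)&\cdots&h_k^s(l_2)\\ \vdots&\vdots&\ddots&\vdots\\ h_0^s(l_p)&h_1^s(l_p)&\cdots&h_k^s(l_p)\end{pmatrix},$$ where, with $\gamma$, $z_1,\dots,z_4$, the $4\times4$ matrix $M$ and the $4\times(k+1)$ matrix $r^s=(r^s_{ij})_{1\le i\le 4,\,0\le j\le k}$ as defined in the context, and $\delta_{j}=0$ if $j=0$, $\delta_j=1$ if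 $j\ge1$, $$h_j^s(x)=-4\gamma^4z_4(x)\,(M^{-1}r^s)_{1j}+z_2(x)\,(M^{-1}r^s)_{2j}+\frac{\delta_j}{EI+\rho ds}\int_0^x z_2(x-y)\psi_j''(y)\,dy\quad\text{for }x\in[0,l_0],$$ $$h_j^s(x)=-4\gamma^4z_4(x-l)\,(M^{-1}r^s)_{3j}+z_2(x-l)\,(M^{-1}r^s)_{4j}-\frac{\delta_j}{EI+\rho ds}\int_x^l z_2(x-y)\psi_j''(y)\,dy\quad\text{for }x\in(l_0,l]$$ (the terms with $\delta_j$ are absent for $j=0$).
   Context: Constants: $l>0$ (beam length), $l_0\in(0,l)$ (point of attachment of the mass-spring shaker), $E,I,\rho,m,\varkappa>0$ and $d\ge0$ are constants (Young's modulus, area moment of inertia, mass per unit length, shaker mass, spring stiffness, structural damping); $l_1,\dots,l_p\in[0,l]$ are sensor locations; $\psi_1,\dots,\psi_k$ are given shape functions on $[0,l]$ whose second derivatives $\psi_j''$ are integrable. Dots denote time derivatives, primes denote derivatives in $x$. Transfer function: $U_j(s)=\int_0^\infty u_j(t)e^{-st}dt$ and $Y_i(s)=\int_0^\infty y_i(t)e^{-st}dt$ are the Laplace transforms of inputs and outputs, and $W_1^s(x)=\int_0^\infty w(x,t)e^{-st}dt$. With zero initial data ($w=\dot w=0$ at $t=0$), the Laplace transform turns the system into a boundary value problem with parameter $s$: $(EI+\rho ds)\,(W_1^s)''''(x)+\rho s^2W_1^s(x)=\sum_{j=1}^k\psi_j''(x)U_j(s)$ on $[0,l_0)$ and $(l_0,l]$;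 $W_1^s$ is of class $C^2[0,l]$; $W_1^s=(W_1^s)''=0$ at $x=0$ and $x=l$; $(ms^2+\varkappa)W_1^s(l_0)=EI(W_1^s)'''(l_0-0)-EI(W_1^s)'''(l_0+0)+U_0(s)$; and $Y_i(s)=(W_1^s)''(l_i)$. The transfer function is the matrix $H(s)$ of the linear map $(U_0,\dots,U_k)\mapsto(Y_1,\dots,Y_p)$ so determined. Here $s$ is a complex parameter with $s\ne0$, $EI+\rho ds\neq0$ and $M$ (below) invertible. Notation: $\alpha$ is such that $\alpha^4=\dfrac{\rho}{EI+\rho ds}$, $\gamma=\dfrac{\alpha\sqrt{2s}}{2}$ (so $4\gamma^4=\alpha^4s^2$; the functions $z_i$ below depend only on $\gamma^4$, so the choice of roots is immaterial), $\beta=\dfrac{s^2m+\varkappa}{EI}$, and $$z_1(x)=\cosh(\gamma x)\cos(\gamma x),\quad z_2(x)=\frac{\cosh(\gamma x)\sin(\gamma x)+\sinh(\gamma x)\cos(\gamma x)}{2\gamma},$$ $$z_3(x)=\frac{\sinh(\gamma x)\sin(\gamma x)}{2\gamma^2},\quad z_4(x)=\frac{\cosh(\gamma x)\sin(\gamma x)-\sinh(\gamma x)\cos(\gamma x)}{4\gamma^3}.$$ $$M=\begin{pmatrix}-z_2(l_0)&-z_4(l_0)&z_2(l_0-l)&z_4(l_0-l)\\-z_1(l_0)&-z_3(l_0)&z_1(l_0-l)&z_3(l_0-l)\\4\gamma^4z_4(l_0)&-z_2(l_0)&-4\gamma^4z_4(l_0-l)&z_2(l_0-l)\\\beta z_2(l_0)+4\gamma^4z_3(l_0)&\beta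 z_4(l_0)-z_1(l_0)&-4\gamma^4z_3(l_0-l)&z_1(l_0-l)\end{pmatrix}.$$ The matrix $r^s$ has column $j=0$ equal to $(0,0,0,1/(EI))^T$, and for $j=1,\dots,k$ $$r^s_{1j}=\frac{\int_0^lz_4(l_0-y)\psi_j''(y)dy}{EI+\rho ds},\quad r^s_{2j}=\frac{\int_0^lz_3(l_0-y)\psi_j''(y)dy}{EI+\rho ds},\quad r^s_{3j}=\frac{\int_0^lz_2(l_0-y)\psi_j''(y)dy}{EI+\rho ds},$$ $$r^s_{4j}=\frac{\int_0^lz_1(l_0-y)\psi_j''(y)dy-\beta\int_0^{l_0}z_4(l_0-y)\psi_j''(y)dy}{EI+\rho ds}.$$ *)

theory Defs
  imports "HOL-Analysis.Analysis"
begin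

record beam =
  len :: real      (* length l *)
  pos :: real      (* attachment point l_0 of the shaker *)
  young :: real    (* Young's modulus E *)
  inertia :: real  (* area moment of inertia I *)
  rho :: real      (* mass per unit length *)
  mass :: real     (* shaker mass m *)
  kappa :: real    (* spring stiffness *)
  damp :: real     (* structural damping d *)

definition valid_beam :: "beam \<Rightarrow> bool" where
  "valid_beam B \<longleftrightarrow> 0 < pos B \<and> pos B < len B \<and> 0 < young B \<and> 0 < inertia B \<and> 0 < rho B
     \<and> 0 < mass B \<and> 0 < kappa B \<and> 0 \<le> damp B"

definition EI :: "beam \<Rightarrow> real" where
  "EI B = young B * inertia B"


text \<open>Because the second derivatives of the shape functions are only integrable, the highest
  spatial derivatives exist in the sense of Caratheodory: for an interval \<open>S\<close>,
  \<open>has_ac_derivative f g S\<close> says that \<open>f\<close> is absolutely continuous on \<open>S\<close>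
  (including one-sided limits at missing end points) with integrable almost-everywhere
  derivative \<open>g\<close>.\<close>

definition has_ac_derivative ::
    "(real \<Rightarrow> 'a::euclidean_space) \<Rightarrow> (real \<Rightarrow> 'a) \<Rightarrow> real set \<Rightarrow> bool" where
  "has_ac_derivative f g S \<longleftrightarrow> g absolutely_integrable_on S \<and>
     (\<forall>x\<in>S. \<forall>y\<in>S. x \<le> y \<longrightarrow> f y - f x = integral {x..y} g)"

definition integrable_second_derivative :: "real \<Rightarrow> (real \<Rightarrow> real) \<Rightarrow> (real \<Rightarrow> real) \<Rightarrow> bool" where
  "integrable_second_derivative l f f2 \<longleftrightarrow> (\<exists>f1.
     (\<forall>x\<in>{0..l}. (f has_vector_derivative f1 x) (at x within {0..l})) \<and>
     has_ac_derivative f1 f2 {0..l})"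

text \<open>\<open>beam_profile B D\<close>: \<open>D n\<close> is the \<open>n\<close>-th spatial derivative of the profile \<open>D 0\<close>, which is
  of class \<open>C\<^sup>2\<close> on the whole beam and has third and fourth derivatives on either side of the
  attachment point. The one-sided limits of \<open>D 3\<close> at the attachment point then exist.\<close>

definition beam_profile :: "beam \<Rightarrow> (nat \<Rightarrow> real \<Rightarrow> 'a::euclidean_space) \<Rightarrow> bool" where
  "beam_profile B D \<longleftrightarrow>
     (\<forall>x\<in>{0..len B}. (D 0 has_vector_derivative D 1 x) (at x within {0..len B})) \<and>
     (\<forall>x\<in>{0..len B}. (D 1 has_vector_derivative D 2 x) (at x within {0..len B})) \<and>
     continuous_on {0..len B} (D 2) \<and>
     (\<forall>S\<in>{{0..<pos B}, {pos B<..len B}}.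
        (\<forall>x\<in>S. (D 2 has_vector_derivative D 3 x) (at x within S)) \<and>
        has_ac_derivative (D 3) (D 4) S)"


text \<open>The controlled beam in the time domain with zero initial data: \<open>D n x t\<close> and \<open>V n x t\<close> are
  the \<open>n\<close>-th spatial derivatives of the deflection \<open>w = D 0\<close> and of its velocity \<open>V 0\<close>, and
  \<open>A\<close> is the acceleration; \<open>\<psi>2 j\<close> is the second derivative of the \<open>j\<close>-th shape function,
  \<open>loc i\<close> the \<open>i\<close>-th sensor location, \<open>u 0, \<dots>, u k\<close> are the inputs and \<open>y 1, \<dots>, y p\<close> the
  outputs. The equation of motion is required off a null set of positions \<open>x\<close>.\<close>

definition control_system ::
    "beam \<Rightarrow> nat \<Rightarrow> (nat \<Rightarrow> real \<Rightarrow> real) \<Rightarrow> nat \<Rightarrow> (nat \<Rightarrow> real) \<Rightarrow> (nat \<Rightarrow> real \<Rightarrow> real) \<Rightarrow>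
     (nat \<Rightarrow> real \<Rightarrow> real) \<Rightarrow> (nat \<Rightarrow> real \<Rightarrow> real \<Rightarrow> real) \<Rightarrow> (nat \<Rightarrow> real \<Rightarrow> real \<Rightarrow> real) \<Rightarrow>
     (real \<Rightarrow> real \<Rightarrow> real) \<Rightarrow> bool" where
  "control_system B k \<psi>2 p loc u y D V A \<longleftrightarrow>
     (\<forall>t\<ge>0. beam_profile B (\<lambda>n x. D n x t) \<and> beam_profile B (\<lambda>n x. V n x t)) \<and>
     (\<forall>x\<in>{0..len B}. \<forall>t\<ge>0.
        (D 0 x has_vector_derivative V 0 x t) (at t within {0..}) \<and>
        (V 0 x has_vector_derivative A x t) (at t within {0..})) \<and>
     (\<forall>x\<in>{0..len B}. D 0 x 0 = 0 \<and> V 0 x 0 = 0) \<and>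
     (AE x in lebesgue. x \<in> {0..<pos B} \<union> {pos B<..len B} \<longrightarrow> (\<forall>t\<ge>0.
        A x t + EI B / rho B * D 4 x t + damp B * V 4 x t
          = 1 / rho B * (\<Sum>j=1..k. \<psi>2 j x * u j t))) \<and>
     (\<forall>t\<ge>0. mass B * A (pos B) t + kappa B * D 0 (pos B) t
        = EI B * Lim (at_left (pos B)) (\<lambda>x. D 3 x t)
          - EI B * Lim (at_right (pos B)) (\<lambda>x. D 3 x t) + u 0 t) \<and>
     (\<forall>t\<ge>0. D 0 0 t = 0 \<and> D 0 (len B) t = 0 \<and> D 2 0 t = 0 \<and> D 2 (len B) t = 0) \<and>
     (\<forall>i\<in>{1..p}. \<forall>t\<ge>0. y i t = D 2 (loc i) t)"

definition laplace :: "(real \<Rightarrow> real) \<Rightarrow> complex \<Rightarrow> complex" where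
  "laplace f s = integral {0..} (\<lambda>t. of_real (f t) * exp (- s * of_real t))"

definition laplace_exists :: "(real \<Rightarrow> real) \<Rightarrow> complex \<Rightarrow> bool" where
  "laplace_exists f s \<longleftrightarrow>
     (\<lambda>t. of_real (f t) * exp (- s * of_real t)) absolutely_integrable_on {0..}"

text \<open>The growth condition under which the Laplace transform may be applied termwise to a
  trajectory at \<open>s\<close>: exponential type less than \<open>Re s\<close>, with an integrable spatial envelope.\<close>

definition exp_dominated ::
    "beam \<Rightarrow> real \<Rightarrow> (real \<Rightarrow> real) \<Rightarrow> (real \<Rightarrow> real \<Rightarrow> real) \<Rightarrow> bool" where
  "exp_dominated B \<sigma> g f \<longleftrightarrow>
     set_borel_measurable borel ({0..len B} \<times> {0..}) (\<lambda>(x, t). f x t) \<and>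
     (\<forall>x\<in>{0..len B}. \<forall>t\<ge>0. \<bar>f x t\<bar> \<le> g x * exp (\<sigma> * t))"

definition laplace_admissible ::
    "beam \<Rightarrow> nat \<Rightarrow> complex \<Rightarrow> (nat \<Rightarrow> real \<Rightarrow> real) \<Rightarrow> (nat \<Rightarrow> real \<Rightarrow> real \<Rightarrow> real) \<Rightarrow>
     (nat \<Rightarrow> real \<Rightarrow> real \<Rightarrow> real) \<Rightarrow> (real \<Rightarrow> real \<Rightarrow> real) \<Rightarrow> bool" where
  "laplace_admissible B k s u D V A \<longleftrightarrow>
     (\<forall>j\<le>k. laplace_exists (u j) s) \<and>
     (\<exists>\<sigma> g. \<sigma> < Re s \<and> g absolutely_integrable_on {0..len B} \<and> exp_dominated B \<sigma> g A \<and>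
        (\<forall>n\<le>4. exp_dominated B \<sigma> g (D n) \<and> exp_dominated B \<sigma> g (V n)))"


text \<open>The boundary value problem obtained by Laplace transform, with data \<open>U 0, \<dots>, U k\<close>,
  and the matrix of the induced map from \<open>(U 0, \<dots>, U k)\<close> to the values of the second
  derivative of the solution at the sensor locations. Matrices with \<open>p\<close> rows and \<open>k + 1\<close>
  columns are functions of the indices \<open>i \<in> {1..p}\<close> and \<open>j \<in> {0..k}\<close>.\<close>

definition EI_damped :: "beam \<Rightarrow> complex \<Rightarrow> complex" where
  "EI_damped B s = of_real (EI B) + of_real (rho B) * of_real (damp B) * s"

definition transformed_system ::
    "beam \<Rightarrow> nat \<Rightarrow> (nat \<Rightarrow> real \<Rightarrow> real) \<Rightarrow> complex \<Rightarrow> (nat \<Rightarrow> complex) \<Rightarrow>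
     (nat \<Rightarrow> real \<Rightarrow> complex) \<Rightarrow> bool" where
  "transformed_system B k \<psi>2 s U W \<longleftrightarrow>
     beam_profile B W \<and>
     (AE x in lebesgue. x \<in> {0..<pos B} \<union> {pos B<..len B} \<longrightarrow>
        EI_damped B s * W 4 x + of_real (rho B) * s\<^sup>2 * W 0 x
          = (\<Sum>j=1..k. of_real (\<psi>2 j x) * U j)) \<and>
     W 0 0 = 0 \<and> W 0 (len B) = 0 \<and> W 2 0 = 0 \<and> W 2 (len B) = 0 \<and>
     (of_real (mass B) * s\<^sup>2 + of_real (kappa B)) * W 0 (pos B)
       = of_real (EI B) * Lim (at_left (pos B)) (W 3)
         - of_real (EI B) * Lim (at_right (pos B)) (W 3) + U 0"

definition transfer_matrix ::
    "beam \<Rightarrow> nat \<Rightarrow> (nat \<Rightarrow> real \<Rightarrow> real) \<Rightarrow> nat \<Rightarrow> (nat \<Rightarrow> real) \<Rightarrow> complex \<Rightarrow>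
     (nat \<Rightarrow> nat \<Rightarrow> complex) \<Rightarrow> bool" where
  "transfer_matrix B k \<psi>2 p loc s H \<longleftrightarrow> (\<forall>U.
     (\<exists>W. transformed_system B k \<psi>2 s U W) \<and>
     (\<forall>W. transformed_system B k \<psi>2 s U W \<longrightarrow>
        (\<forall>i\<in>{1..p}. W 2 (loc i) = (\<Sum>j=0..k. H i j * U j))))"


definition z1 :: "complex \<Rightarrow> real \<Rightarrow> complex" where
  "z1 \<gamma> x = cosh (\<gamma> * of_real x) * cos (\<gamma> * of_real x)"

definition z2 :: "complex \<Rightarrow> real \<Rightarrow> complex" where
  "z2 \<gamma> x = (cosh (\<gamma> * of_real x) * sin (\<gamma> * of_real x)
            + sinh (\<gamma> * of_real x) * cos (\<gamma> * of_real x)) / (2 * \<gamma>)"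

definition z3 :: "complex \<Rightarrow> real \<Rightarrow> complex" where
  "z3 \<gamma> x = sinh (\<gamma> * of_real x) * sin (\<gamma> * of_real x) / (2 * \<gamma>\<^sup>2)"

definition z4 :: "complex \<Rightarrow> real \<Rightarrow> complex" where
  "z4 \<gamma> x = (cosh (\<gamma> * of_real x) * sin (\<gamma> * of_real x)
            - sinh (\<gamma> * of_real x) * cos (\<gamma> * of_real x)) / (4 * \<gamma> ^ 3)"

definition beta :: "beam \<Rightarrow> complex \<Rightarrow> complex" where
  "beta B s = (s\<^sup>2 * of_real (mass B) + of_real (kappa B)) / of_real (EI B)"

definition M_matrix :: "beam \<Rightarrow> complex \<Rightarrow> complex \<Rightarrow> complex ^ 4 ^ 4" where
  "M_matrix B s \<gamma> = (let a = pos B; b = pos B - len B; \<beta> = beta B s in vector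
     [vector [- z2 \<gamma> a, - z4 \<gamma> a, z2 \<gamma> b, z4 \<gamma> b],
      vector [- z1 \<gamma> a, - z3 \<gamma> a, z1 \<gamma> b, z3 \<gamma> b],
      vector [4 * \<gamma> ^ 4 * z4 \<gamma> a, - z2 \<gamma> a, - 4 * \<gamma> ^ 4 * z4 \<gamma> b, z2 \<gamma> b],
      vector [\<beta> * z2 \<gamma> a + 4 * \<gamma> ^ 4 * z3 \<gamma> a, \<beta> * z4 \<gamma> a - z1 \<gamma> a,
              - 4 * \<gamma> ^ 4 * z3 \<gamma> b, z1 \<gamma> b]])"

text \<open>Column \<open>j\<close> of the right-hand side matrix.\<close>

definition r_column ::
    "beam \<Rightarrow> (nat \<Rightarrow> real \<Rightarrow> real) \<Rightarrow> complex \<Rightarrow> complex \<Rightarrow> nat \<Rightarrow> complex ^ 4" where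
  "r_column B \<psi>2 s \<gamma> j =
     (if j = 0 then vector [0, 0, 0, 1 / of_real (EI B)]
      else let conv = (\<lambda>z b. integral {0..b} (\<lambda>y. z \<gamma> (pos B - y) * of_real (\<psi>2 j y))) in vector
        [conv z4 (len B) / EI_damped B s,
         conv z3 (len B) / EI_damped B s,
         conv z2 (len B) / EI_damped B s,
         (conv z1 (len B) - beta B s * conv z4 (pos B)) / EI_damped B s])"

definition h_fun ::
    "beam \<Rightarrow> (nat \<Rightarrow> real \<Rightarrow> real) \<Rightarrow> complex \<Rightarrow> complex \<Rightarrow> nat \<Rightarrow> real \<Rightarrow> complex" where
  "h_fun B \<psi>2 s \<gamma> j x =
     (let c = matrix_inv (M_matrix B s \<gamma>) *v r_column B \<psi>2 s \<gamma> j;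
          \<delta> = (if j = 0 then 0 else 1)
      in if x \<le> pos B
         then - 4 * \<gamma> ^ 4 * z4 \<gamma> x * c $ 1 + z2 \<gamma> x * c $ 2
              + \<delta> / EI_damped B s * integral {0..x} (\<lambda>y. z2 \<gamma> (x - y) * of_real (\<psi>2 j y))
         else - 4 * \<gamma> ^ 4 * z4 \<gamma> (x - len B) * c $ 3 + z2 \<gamma> (x - len B) * c $ 4
              - \<delta> / EI_damped B s
                * integral {x..len B} (\<lambda>y. z2 \<gamma> (x - y) * of_real (\<psi>2 j y)))"

end

theory Submission
  imports Defs
begin

text \<open>
  Differentiating gives \<open>z4' = z3\<close>, \<open>z3' = z2\<close>, \<open>z2' = z1\<close>, \<open>z1' = - 4 \<gamma>^4 z4\<close>, so \<open>z4\<close> is the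
  impulse response of \<open>D\<^sup>4 W + 4 \<gamma>^4 W = F\<close>, to which the transformed equation reduces.
  Variation of constants from either end of the beam expresses \<open>W\<close> on each half by the values of
  \<open>D W\<close> and \<open>D\<^sup>3 W\<close> at that end, where \<open>W\<close> and \<open>D\<^sup>2 W\<close> vanish. Matching \<open>W\<close>,
  \<open>D W\<close>, \<open>D\<^sup>2 W\<close> at the attachment point, together with the force balance there, is the
  linear system with matrix \<open>M\<close>; its solution inserted into the formula for \<open>D\<^sup>2 W\<close> gives
  \<open>H\<close>. As the load is only integrable, this calculus is done for absolutely continuous functions.

  In the time domain, the exponential bound allows Fubini's theorem to interchange the Laplace
  transform with integration in \<open>x\<close>, so the transforms of the spatial derivatives are the spatial
  derivatives of the transform.
\<close>

section \<open>Absolutely continuous functions\<close>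

text \<open>Besides uniqueness, a solution of the boundary value problem is needed for every
  \<open>U\<close>. Both follow from one equivalence, \<open>matching_conditions\<close>, about two
  solutions under the same load, \<open>L\<close> started at the left end and \<open>R\<close> at
  the right end. Each is continued over the whole beam, past the attachment point, so that the jump
  of the third derivative becomes a difference of two ordinary values at \<open>pos B\<close>
  instead of one-sided limits. A given deflection yields such a pair by comparison on either side;
  conversely, a solution of the linear system yields a pair that can be cut at \<open>pos B\<close>
  and glued. Derivatives are handled as increments equal to integrals. This form survives null sets,
  products and Fubini's theorem, so nothing is differentiated under an integral sign; a classical
  derivative is recovered wherever the next derivative is continuous. The price is that a fourth
  derivative is determined only up to a null set, which matters with damping: the transforms of
  \<open>D 4\<close> and \<open>V 4\<close> cannot be assumed proportional at every point.\<close>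

lemma has_ac_derivative_subset:
  assumes "has_ac_derivative f g S" "{u..v} \<subseteq> S"
  shows "has_ac_derivative f g {u..v}"
  unfolding has_ac_derivative_def
proof (intro conjI ballI impI)
  show "g absolutely_integrable_on {u..v}"
    using absolutely_integrable_on_subinterval assms unfolding has_ac_derivative_def by blast
  show "f y - f x = integral {x..y} g" if "x \<in> {u..v}" "y \<in> {u..v}" "x \<le> y" for x y
    using assms that unfolding has_ac_derivative_def by (meson subsetD)
qed

lemma has_ac_derivative_absolutely_integrable:
  "has_ac_derivative f g S \<Longrightarrow> g absolutely_integrable_on S"
  by (simp add: has_ac_derivative_def)

lemma has_ac_derivative_diff_eq:
  "has_ac_derivative f g S \<Longrightarrow> x \<in> S \<Longrightarrow> y \<in> S \<Longrightarrow> x \<le> y \<Longrightarrow> f y - f x = integral {x..y} g"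
  by (simp add: has_ac_derivative_def)

lemma absolutely_integrable_imp_integrable_subinterval:
  fixes f :: "real \<Rightarrow> 'b::euclidean_space"
  shows "f absolutely_integrable_on S \<Longrightarrow> {a..b} \<subseteq> S \<Longrightarrow> f integrable_on {a..b}"
  by (meson absolutely_integrable_on_subinterval set_lebesgue_integral_eq_integral(1))

lemma has_ac_derivative_integral:
  fixes g :: "real \<Rightarrow> 'a::euclidean_space"
  assumes "g absolutely_integrable_on {u..v}"
  shows "has_ac_derivative (\<lambda>x. integral {u..x} g) g {u..v}"
proof -
  have "integral {u..y} g - integral {u..x} g = integral {x..y} g"
    if "x \<in> {u..v}" "y \<in> {u..v}" "x \<le> y" for x y
    using that Henstock_Kurzweil_Integration.integral_combine[where a=u and c=x and b=y and f=g]
      absolutely_integrable_imp_integrable_subinterval[OF assms, of u y]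
    by (auto simp: algebra_simps)
  then show ?thesis using assms by (auto simp: has_ac_derivative_def)
qed

lemma has_ac_derivative_continuous:
  fixes f :: "real \<Rightarrow> 'a::euclidean_space"
  assumes "has_ac_derivative f g {u..v}"
  shows "continuous_on {u..v} f"
proof (cases "u \<le> v")
  case True
  have g: "g integrable_on {u..v}"
    using assms has_ac_derivative_absolutely_integrable set_lebesgue_integral_eq_integral(1) by blast
  have "f x = f u + integral {u..x} g" if "x \<in> {u..v}" for x
    using has_ac_derivative_diff_eq[OF assms, of u x] that by (auto simp: algebra_simps)
  then show ?thesis
    using continuous_on_eq[OF continuous_on_add[OF continuous_on_const indefinite_integral_continuous_1[OF g]]]
    by metis
qed auto

text \<open>The last hypothesis makes \<open>S\<close> an interval, so that the integrals over
  \<open>{x..y}\<close> see only values on \<open>S\<close>. In this form the lemma also serves the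
  half-open halves of the beam.\<close>

lemma has_ac_derivative_cong:
  assumes "has_ac_derivative f g S" "\<And>x. x \<in> S \<Longrightarrow> f x = f' x" "\<And>x. x \<in> S \<Longrightarrow> g x = g' x"
    "\<And>x y. x \<in> S \<Longrightarrow> y \<in> S \<Longrightarrow> {x..y} \<subseteq> S"
  shows "has_ac_derivative f' g' S"
proof -
  have "g' absolutely_integrable_on S"
    using assms(1,3) has_ac_derivative_absolutely_integrable
      absolutely_integrable_spike[where f=g and T=S and S="{}" and g=g'] by auto
  moreover have "f' y - f' x = integral {x..y} g'" if "x \<in> S" "y \<in> S" "x \<le> y" for x y
  proof -
    have "integral {x..y} g' = integral {x..y} g"
      using assms(3) assms(4)[OF that(1,2)]
      by (intro Henstock_Kurzweil_Integration.integral_cong) (auto simp: subset_iff)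
    then show ?thesis using has_ac_derivative_diff_eq[OF assms(1)] that assms(2) by auto
  qed
  ultimately show ?thesis by (simp add: has_ac_derivative_def)
qed

text \<open>The differential equation holds only off a null set; this is how it may nevertheless be
  substituted into a derivative.\<close>

lemma has_ac_derivative_AE_eq:
  assumes "has_ac_derivative f g {u..v}" "AE x in lebesgue. x \<in> {u..v} \<longrightarrow> g x = g' x"
  shows "has_ac_derivative f g' {u..v}"
proof -
  obtain N where N: "negligible N" "{x. \<not> (x \<in> {u..v} \<longrightarrow> g x = g' x)} \<subseteq> N"
    using assms(2) unfolding eventually_ae_filter negligible_iff_null_sets by auto
  have "g' absolutely_integrable_on {u..v}"
    by (rule absolutely_integrable_spike[OF has_ac_derivative_absolutely_integrable[OF assms(1)] N(1)])
      (use N(2) in auto)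
  moreover have "integral {x..y} g' = integral {x..y} g" if "x \<in> {u..v}" "y \<in> {u..v}" for x y
  proof (rule integral_spike[OF N(1)])
    fix t assume "t \<in> {x..y} - N"
    then have "t \<in> {u..v}" "t \<notin> N" using that by auto
    then show "g t = g' t" using N(2) by blast
  qed
  ultimately show ?thesis using assms(1) by (simp add: has_ac_derivative_def)
qed

lemma has_ac_derivative_add:
  assumes "has_ac_derivative f g {u..v}" "has_ac_derivative f' g' {u..v}"
  shows "has_ac_derivative (\<lambda>x. f x + f' x) (\<lambda>x. g x + g' x) {u..v}"
  unfolding has_ac_derivative_def
proof (intro conjI ballI impI)
  show "(\<lambda>x. g x + g' x) absolutely_integrable_on {u..v}"
    using assms by (intro set_integral_add) (simp_all only: has_ac_derivative_def)
  fix x y assume xy: "x \<in> {u..v}" "y \<in> {u..v}" "x \<le> y"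
  then have "{x..y} \<subseteq> {u..v}" by auto
  then have "integral {x..y} (\<lambda>x. g x + g' x) = integral {x..y} g + integral {x..y} g'"
    using assms[THEN has_ac_derivative_absolutely_integrable,
        THEN absolutely_integrable_imp_integrable_subinterval, of x y]
    by (intro Henstock_Kurzweil_Integration.integral_add)
  then show "f y + f' y - (f x + f' x) = integral {x..y} (\<lambda>x. g x + g' x)"
    using assms[THEN has_ac_derivative_diff_eq, OF xy] by (simp only: algebra_simps)
qed

lemma has_ac_derivative_const: "has_ac_derivative (\<lambda>_. c) (\<lambda>_. 0) S"
  by (simp add: has_ac_derivative_def set_integrable_def)

lemma has_ac_derivative_sum:
  assumes "\<And>i. i \<in> I \<Longrightarrow> has_ac_derivative (f i) (g i) {u..v}"
  shows "has_ac_derivative (\<lambda>x. \<Sum>i\<in>I. f i x) (\<lambda>x. \<Sum>i\<in>I. g i x) {u..v}"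
  using assms
proof (induction I rule: infinite_finite_induct)
  case (insert i I)
  then show ?case by (simp add: has_ac_derivative_add)
qed (auto simp: has_ac_derivative_const)

lemma has_ac_derivative_of_vector_derivative:
  fixes f :: "real \<Rightarrow> 'a::euclidean_space"
  assumes "\<And>x. x \<in> {u..v} \<Longrightarrow> (f has_vector_derivative g x) (at x within {u..v})"
    and "continuous_on {u..v} g"
  shows "has_ac_derivative f g {u..v}"
proof -
  have "integral {x..y} g = f y - f x" if "x \<in> {u..v}" "y \<in> {u..v}" "x \<le> y" for x y
  proof -
    have "{x..y} \<subseteq> {u..v}" using that by auto
    then have "(g has_integral f y - f x) {x..y}"
      using that by (intro fundamental_theorem_of_calculus)
        (auto intro!: has_vector_derivative_within_subset[OF assms(1) \<open>{x..y} \<subseteq> {u..v}\<close>])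
    then show ?thesis by blast
  qed
  then show ?thesis
    using absolutely_integrable_continuous_real[OF assms(2)] by (simp add: has_ac_derivative_def)
qed

text \<open>Up to a constant \<open>f\<close> is the indefinite integral of \<open>g\<close>, and
  continuity of \<open>g\<close> upgrades its almost-everywhere derivative to one at every point,
  one-sided at the ends.\<close>

lemma has_vector_derivative_of_ac_derivative:
  fixes f :: "real \<Rightarrow> 'a::euclidean_space"
  assumes "has_ac_derivative f g {u..v}" "continuous_on {u..v} g" "x \<in> {u..v}"
  shows "(f has_vector_derivative g x) (at x within {u..v})"
proof -
  have "((\<lambda>x. f u + integral {u..x} g) has_vector_derivative 0 + g x) (at x within {u..v})"
    by (intro has_vector_derivative_add has_vector_derivative_const
        integral_has_vector_derivative assms)
  then have *: "((\<lambda>x. f u + integral {u..x} g) has_vector_derivative g x) (at x within {u..v})"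
    by (simp only: add_0)
  have "f x = f u + integral {u..x} g" if "x \<in> {u..v}" for x
    using has_ac_derivative_diff_eq[OF assms(1), of u x] that by (auto simp: algebra_simps)
  then show ?thesis
    by (rule has_vector_derivative_transform[OF assms(3) _ *])
qed

section \<open>Products of differentiable and absolutely continuous functions\<close>

lemma absolutely_integrable_continuous_mult:
  fixes p f :: "real \<Rightarrow> complex"
  assumes "continuous_on {u..v} p" "f absolutely_integrable_on {u..v}"
  shows "(\<lambda>x. p x * f x) absolutely_integrable_on {u..v}"
  by (rule absolutely_integrable_bounded_measurable_product[where h="(*)"])
     (use assms in \<open>auto intro!: bilinear_times continuous_imp_measurable_on_sets_lebesgue
        compact_imp_bounded compact_continuous_image\<close>)

text \<open>The defect of the product rule over \<open>[x, y]\<close> is at most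
  \<open>2 C (y - x) \<integral>\<^bsub>[x,y]\<^esub> |f|\<close>, which is \<open>o(y - x)\<close>; hence the defect is constant,
  although \<open>F\<close> need not be differentiable anywhere in particular.\<close>

lemma has_ac_derivative_mult:
  fixes p F f :: "real \<Rightarrow> complex"
  assumes p: "\<And>x. x \<in> {u..v} \<Longrightarrow> (p has_vector_derivative p' x) (at x within {u..v})"
    and p': "continuous_on {u..v} p'"
    and F: "has_ac_derivative F f {u..v}"
  shows "has_ac_derivative (\<lambda>x. p x * F x) (\<lambda>x. p' x * F x + p x * f x) {u..v}"
proof (cases "u \<le> v")
  case False
  then show ?thesis by (auto simp: has_ac_derivative_def)
next
  case True
  have cp: "continuous_on {u..v} p"
    using p continuous_on_vector_derivative by blast
  have cF: "continuous_on {u..v} F" by (rule has_ac_derivative_continuous[OF F])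
  have f: "f absolutely_integrable_on {u..v}"
    by (rule has_ac_derivative_absolutely_integrable[OF F])
  have acp: "has_ac_derivative p p' {u..v}"
    by (rule has_ac_derivative_of_vector_derivative[OF p p'])
  define G where "G = (\<lambda>x. p' x * F x + p x * f x)"
  have G: "G absolutely_integrable_on {u..v}"
    unfolding G_def by (intro set_integral_add absolutely_integrable_continuous_real
        continuous_intros absolutely_integrable_continuous_mult cp cF f p')
  obtain C where C: "\<And>x. x \<in> {u..v} \<Longrightarrow> norm (p' x) \<le> C" "C > 0"
    using compact_imp_bounded[OF compact_continuous_image[OF p']] bounded_pos
    by (metis compact_Icc imageI)
  \<comment> \<open>\<open>N\<close> serves twice: its increments bound those of \<open>F\<close>,
    and its continuity makes the factor \<open>N y - N x\<close> of the defect bound tend to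
    0.\<close>
  define N where "N = (\<lambda>x. integral {u..x} (\<lambda>x. norm (f x)))"
  have nf: "(\<lambda>x. norm (f x)) absolutely_integrable_on {u..v}"
    using f by (rule absolutely_integrable_norm[unfolded comp_def])
  have acN: "has_ac_derivative N (\<lambda>x. norm (f x)) {u..v}"
    unfolding N_def by (rule has_ac_derivative_integral[OF nf])
  define R where "R = (\<lambda>x. p x * F x - integral {u..x} G)"
  have acIG: "has_ac_derivative (\<lambda>x. integral {u..x} G) G {u..v}"
    by (rule has_ac_derivative_integral[OF G])
  have bound: "norm (R y - R x) \<le> 2 * C * (y - x) * (N y - N x)"
    if xy: "x \<in> {u..v}" "y \<in> {u..v}" "x \<le> y" for x y
  proof -
    have sub: "{x..y} \<subseteq> {u..v}" using xy by auto
    have i: "p' integrable_on {x..y}" "f integrable_on {x..y}" "G integrable_on {x..y}"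
      "(\<lambda>x. norm (f x)) integrable_on {x..y}"
      by (rule absolutely_integrable_imp_integrable_subinterval[OF _ sub];
          fact absolutely_integrable_continuous_real[OF p'] f G nf)+
    have Nxy: "N y - N x = integral {x..y} (\<lambda>x. norm (f x))"
      by (rule has_ac_derivative_diff_eq[OF acN xy])
    have FN: "norm (F y - F t) \<le> N y - N x" if t: "t \<in> {x..y}" for t
    proof -
      have tuv: "t \<in> {u..v}" "{t..y} \<subseteq> {u..v}" using t sub by auto
      have "norm (F y - F t) = norm (integral {t..y} f)"
        using has_ac_derivative_diff_eq[OF F, of t y] t xy tuv by auto
      also have "\<dots> \<le> integral {t..y} (\<lambda>x. norm (f x))"
        by (intro integral_norm_bound_integral absolutely_integrable_imp_integrable_subinterval[OF f tuv(2)]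
            absolutely_integrable_imp_integrable_subinterval[OF nf tuv(2)]) auto
      also have "\<dots> \<le> integral {x..y} (\<lambda>x. norm (f x))"
        by (rule integral_subset_le)
          (use t i absolutely_integrable_imp_integrable_subinterval[OF nf tuv(2)] in auto)
      finally show ?thesis using Nxy by simp
    qed
    have pC: "norm (p x - p t) \<le> C * (y - x)" if t: "t \<in> {x..y}" for t
    proof -
      have tuv: "t \<in> {u..v}" "{x..t} \<subseteq> {u..v}" using t sub by auto
      have "norm (p x - p t) = norm (integral {x..t} p')"
        using has_ac_derivative_diff_eq[OF acp, of x t] t xy tuv by (metis atLeastAtMost_iff norm_minus_commute)
      also have "\<dots> \<le> C * (t - x)"
        using integral_bound[of x t p' C] t tuv continuous_on_subset[OF p'] C(1) by (auto simp: subset_iff)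
      also have "\<dots> \<le> C * (y - x)" using t C by auto
      finally show ?thesis .
    qed
    \<comment> \<open>The increment of the product splits as
      \<open>(p y - p x) * F y + p x * (F y - F x)\<close>, with \<open>F\<close> frozen at the
      right end and \<open>p\<close> at the left. Subtracting \<open>G\<close> leaves two terms with
      the small factors \<open>F y - F t\<close> and \<open>p x - p t\<close>; each contributes one
      copy of \<open>C * (y - x) * (N y - N x)\<close>.\<close>
    have "((\<lambda>t. p' t * F y) has_integral (p y - p x) * F y) {x..y}"
      using has_ac_derivative_diff_eq[OF acp xy] i(1)
      by (intro has_integral_mult_left) (simp add: has_integral_integral[symmetric])
    moreover have "((\<lambda>t. p x * f t) has_integral p x * (F y - F x)) {x..y}"
      using has_ac_derivative_diff_eq[OF F xy] i(2)
      by (intro has_integral_mult_right) (simp add: has_integral_integral[symmetric])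
    moreover have "(G has_integral integral {u..y} G - integral {u..x} G) {x..y}"
      using has_ac_derivative_diff_eq[OF acIG xy] i(3) by (simp add: has_integral_integral[symmetric])
    ultimately have "((\<lambda>t. p' t * F y + p x * f t - G t) has_integral
        (p y - p x) * F y + p x * (F y - F x) - (integral {u..y} G - integral {u..x} G)) {x..y}"
      by (intro has_integral_diff has_integral_add)
    moreover have "(p y - p x) * F y + p x * (F y - F x) - (integral {u..y} G - integral {u..x} G) = R y - R x"
      by (simp add: R_def algebra_simps)
    moreover have "(\<lambda>t. p' t * F y + p x * f t - G t) = (\<lambda>t. p' t * (F y - F t) + (p x - p t) * f t)"
      by (simp add: G_def algebra_simps fun_eq_iff)
    ultimately have hi: "((\<lambda>t. p' t * (F y - F t) + (p x - p t) * f t) has_integral R y - R x) {x..y}"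
      by simp
    have "norm (R y - R x) = norm (integral {x..y} (\<lambda>t. p' t * (F y - F t) + (p x - p t) * f t))"
      using hi by (simp add: integral_unique)
    also have "\<dots> \<le> integral {x..y} (\<lambda>t. C * (N y - N x) + C * (y - x) * norm (f t))"
    proof (rule integral_norm_bound_integral)
      show "(\<lambda>t. C * (N y - N x) + C * (y - x) * norm (f t)) integrable_on {x..y}"
        by (intro integrable_add integrable_on_mult_right i integrable_const_ivl)
      fix t assume t: "t \<in> {x..y}"
      have "norm (p' t * (F y - F t)) \<le> C * (N y - N x)"
        unfolding norm_mult using C(1)[of t] FN[OF t] t sub C(2)
        by (intro mult_mono) auto
      moreover have "norm ((p x - p t) * f t) \<le> C * (y - x) * norm (f t)"
        unfolding norm_mult using pC[OF t] by (intro mult_right_mono) auto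
      ultimately show "norm (p' t * (F y - F t) + (p x - p t) * f t) \<le> C * (N y - N x) + C * (y - x) * norm (f t)"
        by (rule norm_triangle_mono)
    qed (use hi in blast)
    also have "\<dots> = C * (N y - N x) * (y - x) + C * (y - x) * (N y - N x)"
    proof -
      have "((\<lambda>t. C * (N y - N x) + C * (y - x) * norm (f t)) has_integral
          (y - x) *\<^sub>R (C * (N y - N x)) + C * (y - x) * (N y - N x)) {x..y}"
      proof (intro has_integral_add has_integral_mult_right)
        show "((\<lambda>t. C * (N y - N x)) has_integral (y - x) *\<^sub>R (C * (N y - N x))) {x..y}"
          using has_integral_const_real[of "C * (N y - N x)" x y] xy by simp
        show "((\<lambda>t. norm (f t)) has_integral N y - N x) {x..y}"
          using i(4) Nxy by (simp add: has_integral_integral)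
      qed
      then show ?thesis by (simp add: integral_unique mult.commute)
    qed
    finally show ?thesis by (simp add: algebra_simps)
  qed
  have Ncont: "continuous_on {u..v} N" by (rule has_ac_derivative_continuous[OF acN])
  have "(R has_vector_derivative 0) (at x within {u..v})" if x: "x \<in> {u..v}" for x
    unfolding has_vector_derivative_def scaleR_zero_right
  proof (rule has_derivativeI)
    show "((\<lambda>y. (R y - R x - 0) /\<^sub>R norm (y - x)) \<longlongrightarrow> 0) (at x within {u..v})"
    proof (rule Lim_null_comparison)
      show "\<forall>\<^sub>F y in at x within {u..v}. norm ((R y - R x - 0) /\<^sub>R norm (y - x)) \<le> 2 * C * \<bar>N y - N x\<bar>"
        unfolding eventually_at_filter
      proof (rule always_eventually, safe)
        fix y assume "y \<noteq> x" "y \<in> {u..v}"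
        have "norm (R y - R x) \<le> 2 * C * \<bar>y - x\<bar> * \<bar>N y - N x\<bar>"
        proof (cases "x \<le> y")
          case True
          then have "norm (R y - R x) \<le> 2 * C * (y - x) * (N y - N x)"
            using bound x \<open>y \<in> {u..v}\<close> by blast
          also have "\<dots> \<le> 2 * C * \<bar>y - x\<bar> * \<bar>N y - N x\<bar>"
            using C(2) True by (simp add: mult_left_mono)
          finally show ?thesis .
        next
          case False
          then have "norm (R y - R x) \<le> 2 * C * (x - y) * (N x - N y)"
            using bound[of y x] x \<open>y \<in> {u..v}\<close> by (simp add: norm_minus_commute)
          also have "\<dots> \<le> 2 * C * \<bar>y - x\<bar> * \<bar>N y - N x\<bar>"
            using C(2) False by (simp add: mult_left_mono)
          finally show ?thesis .
        qed
        then show "norm ((R y - R x - 0) /\<^sub>R norm (y - x)) \<le> 2 * C * \<bar>N y - N x\<bar>"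
          using \<open>y \<noteq> x\<close> by (simp add: pos_divide_le_eq divide_inverse[symmetric] mult.commute[of "inverse _"] mult.assoc mult.commute[of "\<bar>y - x\<bar>"])
      qed
      have "(N \<longlongrightarrow> N x) (at x within {u..v})" using Ncont x by (simp add: continuous_on)
      then have "((\<lambda>y. 2 * C * \<bar>N y - N x\<bar>) \<longlongrightarrow> 2 * C * \<bar>N x - N x\<bar>) (at x within {u..v})"
        by (intro tendsto_intros)
      then show "((\<lambda>y. 2 * C * \<bar>N y - N x\<bar>) \<longlongrightarrow> 0) (at x within {u..v})" by simp
    qed
  qed simp
  then obtain c where c: "\<And>x. x \<in> {u..v} \<Longrightarrow> R x = c"
    using has_vector_derivative_zero_constant[of "{u..v}" R] by auto
  have "has_ac_derivative (\<lambda>x. c + integral {u..x} G) (\<lambda>x. 0 + G x) {u..v}"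
    by (intro has_ac_derivative_add has_ac_derivative_const acIG)
  then have "has_ac_derivative (\<lambda>x. p x * F x) G {u..v}"
    by (rule has_ac_derivative_cong) (use c in \<open>auto simp: R_def algebra_simps\<close>)
  then show ?thesis unfolding G_def .
qed

section \<open>The equation of the transformed beam\<close>

text \<open>\<open>zd \<gamma> n\<close> is the \<open>n\<close>-th derivative of \<open>z4 \<gamma>\<close>.\<close>

fun zd :: "complex \<Rightarrow> nat \<Rightarrow> real \<Rightarrow> complex" where
  "zd \<gamma> 0 = z4 \<gamma>"
| "zd \<gamma> (Suc 0) = z3 \<gamma>"
| "zd \<gamma> (Suc (Suc 0)) = z2 \<gamma>"
| "zd \<gamma> (Suc (Suc (Suc 0))) = z1 \<gamma>"
| "zd \<gamma> (Suc (Suc (Suc (Suc n)))) = (\<lambda>x. - 4 * \<gamma> ^ 4 * zd \<gamma> n x)"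

lemma z_0: "z1 \<gamma> 0 = 1" "z2 \<gamma> 0 = 0" "z3 \<gamma> 0 = 0" "z4 \<gamma> 0 = 0"
  by (simp_all add: z1_def z2_def z3_def z4_def)

lemma z_has_vector_derivative:
  assumes "\<gamma> \<noteq> 0"
  shows "(z4 \<gamma> has_vector_derivative z3 \<gamma> x) (at x within S)"
    and "(z3 \<gamma> has_vector_derivative z2 \<gamma> x) (at x within S)"
    and "(z2 \<gamma> has_vector_derivative z1 \<gamma> x) (at x within S)"
    and "(z1 \<gamma> has_vector_derivative - 4 * \<gamma> ^ 4 * z4 \<gamma> x) (at x within S)"
  unfolding z1_def[abs_def] z2_def[abs_def] z3_def[abs_def] z4_def[abs_def]
  by (rule has_vector_derivative_real_field, (rule derivative_eq_intros refl)+,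
      use assms in \<open>simp_all add: field_simps power_numeral_reduce\<close>)+

lemma zd_has_vector_derivative:
  assumes "\<gamma> \<noteq> 0"
  shows "(zd \<gamma> n has_vector_derivative zd \<gamma> (Suc n) x) (at x within S)"
  using assms
proof (induction \<gamma> n rule: zd.induct)
  case (5 \<gamma> n)
  then have "((\<lambda>x. - 4 * \<gamma> ^ 4 * zd \<gamma> n x) has_vector_derivative - 4 * \<gamma> ^ 4 * zd \<gamma> (Suc n) x) (at x within S)"
    by (intro has_vector_derivative_mult_right) auto
  then show ?case by simp
qed (use z_has_vector_derivative in \<open>simp_all\<close>)

lemma zd_continuous: "\<gamma> \<noteq> 0 \<Longrightarrow> continuous_on S (zd \<gamma> n)"
  by (rule continuous_on_vector_derivative) (rule zd_has_vector_derivative)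

lemma zd_reflect_has_vector_derivative:
  assumes "\<gamma> \<noteq> 0"
  shows "((\<lambda>t. zd \<gamma> n (c - t)) has_vector_derivative - zd \<gamma> (Suc n) (c - t)) (at t within S)"
proof -
  have "((\<lambda>t. c - t) has_vector_derivative - 1) (at t within S)"
    by (auto intro!: derivative_eq_intros)
  then have "((zd \<gamma> n \<circ> (\<lambda>t. c - t)) has_vector_derivative (- 1) *\<^sub>R zd \<gamma> (Suc n) (c - t)) (at t within S)"
    by (rule vector_diff_chain_within) (rule zd_has_vector_derivative[OF assms])
  then show ?thesis by (simp add: comp_def)
qed

lemma zd_reflect_continuous: "\<gamma> \<noteq> 0 \<Longrightarrow> continuous_on S (\<lambda>t. zd \<gamma> n (c - t))"
  by (rule continuous_on_vector_derivative) (rule zd_reflect_has_vector_derivative)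

text \<open>The bound is sharp, as \<open>zd \<gamma> 7 0\<close> is
  \<open>- 4 * \<gamma> ^ 4\<close>. It just covers the indices \<open>3 - i + n\<close> with
  \<open>i\<close> and \<open>n\<close> below 4, which equal 3 only for
  \<open>i = n\<close>.\<close>

lemma zd_0: "m < 7 \<Longrightarrow> zd \<gamma> m 0 = (if m = 3 then 1 else 0)"
  by (auto simp: less_Suc_eq numeral_eq_Suc z_0)

lemma sum_lessThan_4: "(\<Sum>i<(4::nat). f i) = f 0 + f 1 + f 2 + f 3"
  by (simp add: numeral_eq_Suc)

text \<open>Addition theorem for the fundamental solution. With the sum of the arguments fixed, the
  derivative along \<open>t\<close> telescopes, and the two surviving end terms cancel because
  \<open>zd \<gamma> (n + 4)\<close> is \<open>- 4 * \<gamma> ^ 4\<close> times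
  \<open>zd \<gamma> n\<close>. At \<open>t = 0\<close> only the term \<open>i = 3\<close> is
  left.\<close>

lemma zd_add:
  assumes "\<gamma> \<noteq> 0"
  shows "(\<Sum>i<4. zd \<gamma> (3 - i + n) x * zd \<gamma> i y) = zd \<gamma> n (x + y)"
proof -
  define q where "q = (\<lambda>t. \<Sum>i<4. zd \<gamma> (3 - i + n) (x + y - t) * zd \<gamma> i t)"
  have "(q has_vector_derivative 0) (at t within UNIV)" for t
  proof -
    have "(q has_vector_derivative (\<Sum>i<4. zd \<gamma> (3 - i + n) (x + y - t) * zd \<gamma> (Suc i) t
        + - zd \<gamma> (Suc (3 - i + n)) (x + y - t) * zd \<gamma> i t)) (at t within UNIV)"
      unfolding q_def
      by (intro has_vector_derivative_sum has_vector_derivative_mult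
          zd_has_vector_derivative zd_reflect_has_vector_derivative assms)
    then show ?thesis by (simp add: sum_lessThan_4 numeral_eq_Suc)
  qed
  then obtain c where "\<And>t. q t = c"
    using has_vector_derivative_zero_constant[of UNIV q] by auto
  then have "q y = q 0" by simp
  moreover have "q 0 = zd \<gamma> n (x + y)"
    by (simp add: q_def sum_lessThan_4 zd_0 z_0 numeral_eq_Suc)
  ultimately show ?thesis by (simp add: q_def)
qed

section \<open>Solution theory of the fourth-order equation with integrable load\<close>

text \<open>Caratheodory form of the equation, with \<open>F\<close> already divided by the leading
  coefficient. No jump of \<open>W 3\<close> is allowed, so over the whole beam this describes the
  continuation of a solution from one half, not the deflection itself.\<close>

definition beam_ode :: "complex \<Rightarrow> (real \<Rightarrow> complex) \<Rightarrow> real set \<Rightarrow> (nat \<Rightarrow> real \<Rightarrow> complex) \<Rightarrow> bool" where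
  "beam_ode \<gamma> F S W \<longleftrightarrow> (\<forall>i<4. has_ac_derivative (W i) (W (Suc i)) S) \<and>
     (AE x in lebesgue. x \<in> S \<longrightarrow> W 4 x + 4 * \<gamma> ^ 4 * W 0 x = F x)"

lemma beam_ode_subset:
  assumes "beam_ode \<gamma> F S W" "{u..v} \<subseteq> S"
  shows "beam_ode \<gamma> F {u..v} W"
  using assms unfolding beam_ode_def
  by (auto intro!: has_ac_derivative_subset[OF _ assms(2)] elim!: eventually_mono)

text \<open>The sum is the Lagrange bilinear concomitant of \<open>W\<close> and the adjoint solution
  \<open>t \<mapsto> zd \<gamma> n (c - t)\<close>; at \<open>t = c\<close> it reduces to \<open>W n c\<close>.\<close>

lemma beam_ode_concomitant:
  assumes "\<gamma> \<noteq> 0" "beam_ode \<gamma> F {u..v} W"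
  shows "has_ac_derivative (\<lambda>t. \<Sum>i<4. zd \<gamma> (3 - i + n) (c - t) * W i t)
    (\<lambda>t. zd \<gamma> n (c - t) * F t) {u..v}"
proof (rule has_ac_derivative_AE_eq)
  show "has_ac_derivative (\<lambda>t. \<Sum>i<4. zd \<gamma> (3 - i + n) (c - t) * W i t)
    (\<lambda>t. \<Sum>i<4. - zd \<gamma> (Suc (3 - i + n)) (c - t) * W i t + zd \<gamma> (3 - i + n) (c - t) * W (Suc i) t) {u..v}"
    using assms unfolding beam_ode_def
    by (intro has_ac_derivative_sum has_ac_derivative_mult zd_reflect_has_vector_derivative
        continuous_on_minus zd_reflect_continuous) auto
  have "(\<Sum>i<4. - zd \<gamma> (Suc (3 - i + n)) (c - t) * W i t + zd \<gamma> (3 - i + n) (c - t) * W (Suc i) t)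
    = zd \<gamma> n (c - t) * (W 4 t + 4 * \<gamma> ^ 4 * W 0 t)" for t
    by (simp add: sum_lessThan_4 numeral_eq_Suc algebra_simps)
  then show "AE t in lebesgue. t \<in> {u..v} \<longrightarrow>
    (\<Sum>i<4. - zd \<gamma> (Suc (3 - i + n)) (c - t) * W i t + zd \<gamma> (3 - i + n) (c - t) * W (Suc i) t)
    = zd \<gamma> n (c - t) * F t"
    using assms(2) unfolding beam_ode_def by (auto elim!: eventually_mono)
qed

lemma concomitant_at_0:
  assumes "n < 4"
  shows "(\<Sum>i<4. zd \<gamma> (3 - i + n) 0 * X i) = X n"
proof -
  consider "n = 0" | "n = 1" | "n = 2" | "n = 3" using assms by linarith
  then show ?thesis by cases (simp_all add: sum_lessThan_4 zd_0)
qed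

text \<open>Both formulas integrate the derivative of the concomitant over \<open>{u..v}\<close>;
  they differ in placing its centre \<open>c\<close> at \<open>v\<close> or at \<open>u\<close>, the
  point where \<open>W n\<close> is to be isolated.\<close>

lemma beam_ode_variation_of_constants:
  assumes "\<gamma> \<noteq> 0" "beam_ode \<gamma> F {u..v} W" "u \<le> v" "n < 4"
  shows "W n v = (\<Sum>i<4. zd \<gamma> (3 - i + n) (v - u) * W i u) + integral {u..v} (\<lambda>t. zd \<gamma> n (v - t) * F t)"
    and "W n u = (\<Sum>i<4. zd \<gamma> (3 - i + n) (u - v) * W i v) - integral {u..v} (\<lambda>t. zd \<gamma> n (u - t) * F t)"
  using has_ac_derivative_diff_eq[OF beam_ode_concomitant[OF assms(1,2), of n v], of u v]
    has_ac_derivative_diff_eq[OF beam_ode_concomitant[OF assms(1,2), of n u], of u v]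
    assms(3) concomitant_at_0[OF assms(4)]
  by (simp_all add: algebra_simps)

lemma beam_ode_unique:
  assumes "\<gamma> \<noteq> 0" "beam_ode \<gamma> F {u..v} W" "beam_ode \<gamma> F {u..v} W'"
    "a \<in> {u..v}" "\<And>i. i < 4 \<Longrightarrow> W i a = W' i a" "x \<in> {u..v}" "n < 4"
  shows "W n x = W' n x"
proof (cases "a \<le> x")
  case True
  have "{a..x} \<subseteq> {u..v}" using assms by auto
  then have "beam_ode \<gamma> F {a..x} W" "beam_ode \<gamma> F {a..x} W'"
    using beam_ode_subset assms(2,3) by blast+
  then show ?thesis
    using assms(5) unfolding beam_ode_variation_of_constants(1)[OF assms(1) \<open>beam_ode \<gamma> F {a..x} W\<close> True assms(7)]
      beam_ode_variation_of_constants(1)[OF assms(1) \<open>beam_ode \<gamma> F {a..x} W'\<close> True assms(7)]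
    by (intro arg_cong2[where f="(+)"] sum.cong refl) auto
next
  case False
  then have "x \<le> a" by simp
  have "{x..a} \<subseteq> {u..v}" using assms by auto
  then have "beam_ode \<gamma> F {x..a} W" "beam_ode \<gamma> F {x..a} W'"
    using beam_ode_subset assms(2,3) by blast+
  then show ?thesis
    using assms(5) unfolding beam_ode_variation_of_constants(2)[OF assms(1) \<open>beam_ode \<gamma> F {x..a} W\<close> \<open>x \<le> a\<close> assms(7)]
      beam_ode_variation_of_constants(2)[OF assms(1) \<open>beam_ode \<gamma> F {x..a} W'\<close> \<open>x \<le> a\<close> assms(7)]
    by (intro arg_cong2[where f="(-)"] sum.cong refl) auto
qed

text \<open>In the Duhamel integral of \<open>zd \<gamma> n (x - y) * F y\<close> the variable
  \<open>x\<close> occurs both in the kernel and as a limit of integration. \<open>zd_add\<close>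
  separates the variables: there remain four products of a smooth function and an indefinite
  integral, to which the product rule for absolutely continuous functions applies.\<close>

lemma beam_ode_exists:
  assumes \<gamma>: "\<gamma> \<noteq> 0" and F: "F absolutely_integrable_on {u..v}" and a: "a \<in> {u..v}"
  obtains W where "beam_ode \<gamma> F {u..v} W" "\<And>i. i < 4 \<Longrightarrow> W i a = X i"
proof -
  define f where "f = (\<lambda>i y. zd \<gamma> i (0 - y) * F y)"
  have f: "f i absolutely_integrable_on {u..v}" for i
    unfolding f_def by (intro absolutely_integrable_continuous_mult zd_reflect_continuous \<gamma> F)
  \<comment> \<open>The subtracted constant makes every \<open>\<Phi> i\<close> vanish at
    \<open>a\<close>, so that \<open>P\<close> does not disturb the initial values carried by
    \<open>Q\<close>.\<close>
  define \<Phi> where "\<Phi> = (\<lambda>i x. integral {u..x} (f i) + - integral {u..a} (f i))"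
  have \<Phi>: "has_ac_derivative (\<Phi> i) (f i) {u..v}" for i
    using has_ac_derivative_add[OF has_ac_derivative_integral[OF f] has_ac_derivative_const[of "- integral {u..a} (f i)"], of i]
    unfolding \<Phi>_def by (simp only: add_0_right)
  define P where "P = (\<lambda>n x. \<Sum>i<4. zd \<gamma> (3 - i + n) x * \<Phi> i x)"
  define Q where "Q = (\<lambda>n x. \<Sum>i<4. zd \<gamma> (3 - i + n) (x + - a) * X i)"
  have P: "has_ac_derivative (P n) (\<lambda>x. P (Suc n) x + zd \<gamma> n 0 * F x) {u..v}" for n
  proof -
    have "has_ac_derivative (P n) (\<lambda>x. \<Sum>i<4. zd \<gamma> (Suc (3 - i + n)) x * \<Phi> i x
        + zd \<gamma> (3 - i + n) x * f i x) {u..v}"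
      unfolding P_def
      by (intro has_ac_derivative_sum has_ac_derivative_mult zd_has_vector_derivative zd_continuous \<gamma> \<Phi>)
    \<comment> \<open>The terms that differentiate \<open>\<Phi>\<close> collapse, by the addition
      theorem at \<open>x\<close> and \<open>- x\<close>, to \<open>zd \<gamma> n 0 * F x\<close>.
      This is 0 for \<open>n < 3\<close> and \<open>F x\<close> for \<open>n = 3\<close>, so the
      load enters exactly at order four.\<close>
    moreover have "(\<Sum>i<4. zd \<gamma> (Suc (3 - i + n)) x * \<Phi> i x + zd \<gamma> (3 - i + n) x * f i x)
      = P (Suc n) x + zd \<gamma> n 0 * F x" for x
      using zd_add[OF \<gamma>, of n x "- x"] unfolding P_def f_def add_Suc_right sum.distrib
      by (simp only: mult.assoc[symmetric] sum_distrib_right[symmetric] diff_0 right_minus)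
    ultimately show ?thesis by simp
  qed
  have Q: "has_ac_derivative (Q n) (Q (Suc n)) {u..v}" for n
  proof (rule has_ac_derivative_of_vector_derivative)
    have shift: "((\<lambda>x. zd \<gamma> m (x + - a)) has_vector_derivative zd \<gamma> (Suc m) (x + - a)) (at x within S)" for m x S
    proof -
      have "((\<lambda>x. x + - a) has_vector_derivative 1) (at x within S)"
        by (auto intro!: derivative_eq_intros)
      then have "((zd \<gamma> m \<circ> (\<lambda>x. x + - a)) has_vector_derivative 1 *\<^sub>R zd \<gamma> (Suc m) (x + - a)) (at x within S)"
        by (rule vector_diff_chain_within) (rule zd_has_vector_derivative[OF \<gamma>])
      then show ?thesis by (simp add: comp_def)
    qed
    show Qd: "(Q n has_vector_derivative Q (Suc n) x) (at x within {u..v})" for x n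
      unfolding Q_def add_Suc_right
      by (intro has_vector_derivative_sum has_vector_derivative_mult_left shift)
    show "continuous_on {u..v} (Q (Suc n))"
      by (rule continuous_on_vector_derivative) (rule Qd)
  qed
  have PQ4: "P (Suc 3) x + Q (Suc 3) x = - (4 * \<gamma> ^ 4 * (P 0 x + Q 0 x))" for x
    by (simp add: P_def Q_def sum_lessThan_4 numeral_eq_Suc algebra_simps)
  \<comment> \<open>From order 4 on, \<open>P n + Q n\<close> would miss the load;
    \<open>W 4\<close> is read off the equation, which therefore holds at every point.\<close>
  define W where "W = (\<lambda>n x. if n < 4 then P n x + Q n x else F x - 4 * \<gamma> ^ 4 * (P 0 x + Q 0 x))"
  have "has_ac_derivative (W n) (W (Suc n)) {u..v}" if "n < 4" for n
  proof -
    have "has_ac_derivative (W n) (\<lambda>x. P (Suc n) x + zd \<gamma> n 0 * F x + Q (Suc n) x) {u..v}"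
      using has_ac_derivative_add[OF P[of n] Q[of n]] that by (simp add: W_def)
    moreover have "P (Suc n) x + zd \<gamma> n 0 * F x + Q (Suc n) x = W (Suc n) x" for x
    proof (cases "n = 3")
      case True
      then show ?thesis using PQ4[of x] by (simp add: W_def zd_0 algebra_simps)
    next
      case False
      then show ?thesis using that by (simp add: W_def zd_0)
    qed
    ultimately show ?thesis by simp
  qed
  moreover have "W 4 x + 4 * \<gamma> ^ 4 * W 0 x = F x" for x by (simp add: W_def)
  ultimately have "beam_ode \<gamma> F {u..v} W" by (simp add: beam_ode_def)
  moreover have "W i a = X i" if "i < 4" for i
    using that concomitant_at_0[of i \<gamma> X] by (simp add: W_def P_def Q_def \<Phi>_def)
  ultimately show ?thesis using that by blast
qed

section \<open>The boundary value problem\<close>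

lemma has_ac_derivative_mono:
  assumes "has_ac_derivative f g S" "T \<subseteq> S" "T \<in> sets lebesgue"
  shows "has_ac_derivative f g T"
  unfolding has_ac_derivative_def
proof (intro conjI ballI impI)
  show "g absolutely_integrable_on T"
    using set_integrable_subset[OF has_ac_derivative_absolutely_integrable[OF assms(1)] assms(3,2)] .
  show "f y - f x = integral {x..y} g" if "x \<in> T" "y \<in> T" "x \<le> y" for x y
    using has_ac_derivative_diff_eq[OF assms(1)] that assms(2) by blast
qed

text \<open>In the applications \<open>f\<close> is continuous across the point, for instance a
  continued solution or an indefinite integral, and \<open>g\<close> is compared with it strictly on
  one side; the value of \<open>g\<close> at the point may differ.\<close>

lemma tendsto_at_left_of_eq:
  fixes f g :: "real \<Rightarrow> 'a::topological_space"
  assumes "continuous_on {u..v} f" "u < x" "x \<le> v" "\<And>y. y \<in> {u..<x} \<Longrightarrow> g y = f y"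
  shows "(g \<longlongrightarrow> f x) (at_left x)"
proof -
  have "continuous (at x within {u..v}) f"
    using assms(1-3) by (simp add: continuous_on_eq_continuous_within)
  then have "(f \<longlongrightarrow> f x) (at x within {u..v})"
    by (simp add: continuous_within)
  moreover have "at_left x \<le> at x within {u..v}"
    by (metis assms(2,3) at_within_Icc_at at_within_Icc_at_left at_within_le_at order_le_less)
  ultimately have "(f \<longlongrightarrow> f x) (at_left x)"
    using filterlim_mono by blast
  moreover have "\<forall>\<^sub>F y in at_left x. f y = g y"
    using eventually_at_left_real[OF assms(2)] by eventually_elim (use assms(4) in auto)
  ultimately show ?thesis by (rule Lim_transform_eventually)
qed


lemma tendsto_at_right_of_eq:
  fixes f g :: "real \<Rightarrow> 'a::topological_space"
  assumes "continuous_on {u..v} f" "u \<le> x" "x < v" "\<And>y. y \<in> {x<..v} \<Longrightarrow> g y = f y"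
  shows "(g \<longlongrightarrow> f x) (at_right x)"
proof -
  have "continuous (at x within {u..v}) f"
    using assms(1-3) by (simp add: continuous_on_eq_continuous_within)
  then have "(f \<longlongrightarrow> f x) (at x within {u..v})"
    by (simp add: continuous_within)
  moreover have "at_right x \<le> at x within {u..v}"
    by (metis assms(2,3) at_within_Icc_at at_within_Icc_at_right at_within_le_at order_le_less)
  ultimately have "(f \<longlongrightarrow> f x) (at_right x)"
    using filterlim_mono by blast
  moreover have "\<forall>\<^sub>F y in at_right x. f y = g y"
    using eventually_at_right_real[OF assms(3)] by eventually_elim (use assms(4) in auto)
  ultimately show ?thesis by (rule Lim_transform_eventually)
qed

lemma integrable_second_derivative_absolutely_integrable:
  "integrable_second_derivative l f f2 \<Longrightarrow> f2 absolutely_integrable_on {0..l}"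
  unfolding integrable_second_derivative_def has_ac_derivative_def by blast

text \<open>Absolute continuity descends from the top: it makes \<open>W 3\<close> continuous, which
  makes the classical derivative of \<open>W 2\<close> integrable with the right increments, and so
  on down to \<open>W 0\<close>.\<close>

lemma beam_profile_has_ac_derivative:
  assumes "valid_beam B" "beam_profile B W" "i < 4"
    "S \<in> {{0..<pos B}, {pos B<..len B}}" "{u..v} \<subseteq> S"
  shows "has_ac_derivative (W i) (W (Suc i)) {u..v}"
proof -
  note v = assms(1)[unfolded valid_beam_def]
  note p = assms(2)[unfolded beam_profile_def]
  have S: "S \<subseteq> {0..len B}" using assms(4) v by auto
  then have sub: "{u..v} \<subseteq> {0..len B}" using assms(5) by blast
  have 3: "has_ac_derivative (W 3) (W 4) {u..v}"
    using p assms(4) by (intro has_ac_derivative_subset[OF _ assms(5)]) blast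
  have d0: "\<And>x. x \<in> {u..v} \<Longrightarrow> (W 0 has_vector_derivative W 1 x) (at x within {u..v})"
    and d1: "\<And>x. x \<in> {u..v} \<Longrightarrow> (W 1 has_vector_derivative W 2 x) (at x within {u..v})"
    and d2: "\<And>x. x \<in> {u..v} \<Longrightarrow> (W 2 has_vector_derivative W 3 x) (at x within {u..v})"
    using p sub assms(4,5) by (meson has_vector_derivative_within_subset subsetD)+
  have c1: "continuous_on {u..v} (W 1)" by (rule continuous_on_vector_derivative[OF d1])
  have c2: "continuous_on {u..v} (W 2)" by (rule continuous_on_vector_derivative[OF d2])
  have c3: "continuous_on {u..v} (W 3)" by (rule has_ac_derivative_continuous[OF 3])
  have 0: "has_ac_derivative (W 0) (W 1) {u..v}"
    by (rule has_ac_derivative_of_vector_derivative[OF d0 c1])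
  have 1: "has_ac_derivative (W 1) (W 2) {u..v}"
    by (rule has_ac_derivative_of_vector_derivative[OF d1 c2])
  have 2: "has_ac_derivative (W 2) (W 3) {u..v}"
    by (rule has_ac_derivative_of_vector_derivative[OF d2 c3])
  consider "i = 0" | "i = 1" | "i = 2" | "i = 3" using assms(3) by linarith
  then show ?thesis using 0 1 2 3 by cases (simp_all add: numeral_eq_Suc)
qed

lemma vector_4:
  "(vector [x, y, z, w] :: ('a::zero)^4) $ 1 = x"
  "(vector [x, y, z, w] :: ('a::zero)^4) $ 2 = y"
  "(vector [x, y, z, w] :: ('a::zero)^4) $ 3 = z"
  "(vector [x, y, z, w] :: ('a::zero)^4) $ 4 = w"
  unfolding vector_def by simp_all

lemma invertible_matrix_inv:
  fixes A :: "'a::semiring_1 ^ 'n ^ 'n"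
  assumes "invertible A"
  shows "A ** matrix_inv A = mat 1" "matrix_inv A ** A = mat 1"
  using someI_ex[OF assms[unfolded invertible_def]] unfolding matrix_inv_def by auto

lemma sum_from_0: "(\<Sum>j=0..k. f j) = f 0 + (\<Sum>j=1..k. f j)" for f :: "nat \<Rightarrow> complex"
  by (simp add: sum.atLeast_Suc_atMost)

lemma beam_ode_continuous:
  assumes "beam_ode \<gamma> F {u..v} L" "n < 4"
  shows "continuous_on {u..v} (L n)"
  using assms has_ac_derivative_continuous unfolding beam_ode_def by blast

lemma beam_ode_has_vector_derivative:
  assumes "beam_ode \<gamma> F {u..v} L" "n < 3" "x \<in> {u..v}"
  shows "(L n has_vector_derivative L (Suc n) x) (at x within {u..v})"
proof (rule has_vector_derivative_of_ac_derivative[OF _ _ assms(3)])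
  show "has_ac_derivative (L n) (L (Suc n)) {u..v}"
    using assms(1,2) by (simp add: beam_ode_def)
  show "continuous_on {u..v} (L (Suc n))"
    using assms(2) by (intro beam_ode_continuous[OF assms(1)]) simp
qed

section \<open>Superposition of inputs and matching at the attachment point\<close>

text \<open>Of the roots that define \<gamma> only two facts are retained: \<gamma> is nonzero, and
  its fourth power turns the transformed equation, divided by \<open>EI_damped B s\<close>, into
  \<open>beam_ode\<close>.\<close>

locale transformed_beam =
  fixes B :: beam and k :: nat and \<psi>2 :: "nat \<Rightarrow> real \<Rightarrow> real" and s \<gamma> :: complex
  assumes valid: "valid_beam B"
    and \<psi>2: "\<And>j. j \<in> {1..k} \<Longrightarrow> \<psi>2 j absolutely_integrable_on {0..len B}"
    and EI_damped_nz: "EI_damped B s \<noteq> 0"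
    and \<gamma>_nz: "\<gamma> \<noteq> 0"
    and \<gamma>_power4: "4 * \<gamma> ^ 4 * EI_damped B s = of_real (rho B) * s\<^sup>2"
begin

lemma pos_len: "0 < pos B" "pos B < len B"
  using valid by (auto simp: valid_beam_def)

lemma EI_nz: "EI B \<noteq> 0"
  using valid by (auto simp: valid_beam_def EI_def)

definition load :: "(nat \<Rightarrow> complex) \<Rightarrow> real \<Rightarrow> complex" where
  "load U y = (\<Sum>j=1..k. of_real (\<psi>2 j y) * U j) / EI_damped B s"

definition rhs :: "(nat \<Rightarrow> complex) \<Rightarrow> complex ^ 4" where
  "rhs U = (\<Sum>j=0..k. U j *s r_column B \<psi>2 s \<gamma> j)"

text \<open>For a solution \<open>W\<close> the entries turn out to be \<open>W 1 0\<close>,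
  \<open>W 3 0\<close>, \<open>W 1 (len B)\<close> and \<open>W 3 (len B)\<close>, the end data that
  the boundary conditions leave open.\<close>

definition coeff :: "(nat \<Rightarrow> complex) \<Rightarrow> complex ^ 4" where
  "coeff U = matrix_inv (M_matrix B s \<gamma>) *v rhs U"

lemma of_real_\<psi>2:
  "j \<in> {1..k} \<Longrightarrow> (\<lambda>y. complex_of_real (\<psi>2 j y)) absolutely_integrable_on {0..len B}"
  using absolutely_integrable_linear[OF \<psi>2 bounded_linear_of_real] by (simp add: comp_def)

lemma load_absolutely_integrable: "load U absolutely_integrable_on {0..len B}"
proof -
  have "(\<lambda>y. complex_of_real (\<psi>2 j y) * U j) absolutely_integrable_on {0..len B}" if "j \<in> {1..k}" for j
    using absolutely_integrable_linear[OF of_real_\<psi>2[OF that] bounded_linear_mult_left[of "U j"]]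
    by (simp add: comp_def)
  then have "(\<lambda>y. \<Sum>j=1..k. complex_of_real (\<psi>2 j y) * U j) absolutely_integrable_on {0..len B}"
    by (intro absolutely_integrable_sum) auto
  from absolutely_integrable_linear[OF this bounded_linear_divide[of "EI_damped B s"]]
  show ?thesis by (simp add: load_def[abs_def] comp_def)
qed

lemma integral_kernel_load:
  assumes "continuous_on {u..v} q" "{u..v} \<subseteq> {0..len B}"
  shows "integral {u..v} (\<lambda>y. q y * load U y)
    = (\<Sum>j=1..k. U j * (integral {u..v} (\<lambda>y. q y * of_real (\<psi>2 j y)) / EI_damped B s))"
proof -
  have "((\<lambda>y. U j * (q y * of_real (\<psi>2 j y) / EI_damped B s)) has_integral
      U j * (integral {u..v} (\<lambda>y. q y * of_real (\<psi>2 j y)) / EI_damped B s)) {u..v}"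
    if "j \<in> {1..k}" for j
  proof -
    have "(\<lambda>y. q y * of_real (\<psi>2 j y)) integrable_on {u..v}"
      using absolutely_integrable_continuous_mult[OF assms(1)
          absolutely_integrable_on_subinterval[OF of_real_\<psi>2[OF that] assms(2)]]
      by (rule set_lebesgue_integral_eq_integral(1))
    then show ?thesis
      by (intro has_integral_mult_right has_integral_divide) (simp add: has_integral_integral)
  qed
  then have "((\<lambda>y. \<Sum>j=1..k. U j * (q y * of_real (\<psi>2 j y) / EI_damped B s)) has_integral
      (\<Sum>j=1..k. U j * (integral {u..v} (\<lambda>y. q y * of_real (\<psi>2 j y)) / EI_damped B s))) {u..v}"
    by (intro has_integral_sum) auto
  moreover have "(\<Sum>j=1..k. U j * (q y * of_real (\<psi>2 j y) / EI_damped B s)) = q y * load U y" for y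
    by (simp add: load_def sum_divide_distrib sum_distrib_left mult_ac)
  ultimately show ?thesis by (simp add: integral_unique)
qed

lemma integral_zd_load:
  assumes "0 \<le> u" "v \<le> len B"
  shows "integral {u..v} (\<lambda>y. zd \<gamma> n (x - y) * load U y)
    = (\<Sum>j=1..k. U j * (integral {u..v} (\<lambda>y. zd \<gamma> n (x - y) * of_real (\<psi>2 j y)) / EI_damped B s))"
  using assms by (intro integral_kernel_load zd_reflect_continuous \<gamma>_nz) auto

text \<open>Applying the inverse of \<open>M\<close> is linear, so the superposed columns of
  \<open>r\<close> combine into the single coefficient vector \<open>coeff U\<close>.\<close>

lemma sum_h_fun:
  "(\<Sum>j=0..k. h_fun B \<psi>2 s \<gamma> j x * U j) =
     (if x \<le> pos B
      then - 4 * \<gamma> ^ 4 * z4 \<gamma> x * coeff U $ 1 + z2 \<gamma> x * coeff U $ 2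
        + (\<Sum>j=1..k. U j * (integral {0..x} (\<lambda>y. z2 \<gamma> (x - y) * of_real (\<psi>2 j y)) / EI_damped B s))
      else - 4 * \<gamma> ^ 4 * z4 \<gamma> (x - len B) * coeff U $ 3 + z2 \<gamma> (x - len B) * coeff U $ 4
        - (\<Sum>j=1..k. U j * (integral {x..len B} (\<lambda>y. z2 \<gamma> (x - y) * of_real (\<psi>2 j y)) / EI_damped B s)))"
proof -
  have c: "coeff U $ i = (\<Sum>j=0..k. U j * (matrix_inv (M_matrix B s \<gamma>) *v r_column B \<psi>2 s \<gamma> j) $ i)" for i
    by (simp add: coeff_def rhs_def vec.sum vec.scale)
  show ?thesis
    unfolding c h_fun_def Let_def
    by (simp add: sum_from_0 sum.distrib sum_distrib_left sum_subtractf sum_negf algebra_simps)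
qed

text \<open>Superposition fuses the integrals over the separate shape functions into integrals
  against \<open>load U\<close>, the form in which variation of constants delivers them: the kernel
  belonging to \<open>W n\<close> is \<open>zd \<gamma> n\<close>.\<close>

lemma rhs_components:
  "rhs U $ 1 = integral {0..len B} (\<lambda>y. zd \<gamma> 0 (pos B - y) * load U y)"
  "rhs U $ 2 = integral {0..len B} (\<lambda>y. zd \<gamma> (Suc 0) (pos B - y) * load U y)"
  "rhs U $ 3 = integral {0..len B} (\<lambda>y. zd \<gamma> (Suc (Suc 0)) (pos B - y) * load U y)"
  "rhs U $ 4 = U 0 / of_real (EI B) + integral {0..len B} (\<lambda>y. zd \<gamma> (Suc (Suc (Suc 0))) (pos B - y) * load U y)
     - beta B s * integral {0..pos B} (\<lambda>y. zd \<gamma> 0 (pos B - y) * load U y)"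
proof -
  have *: "rhs U $ i = U 0 * r_column B \<psi>2 s \<gamma> 0 $ i + (\<Sum>j=1..k. U j * r_column B \<psi>2 s \<gamma> j $ i)" for i
    by (simp add: rhs_def sum_from_0)
  have col: "(\<Sum>j=1..k. U j * r_column B \<psi>2 s \<gamma> j $ i) = (\<Sum>j=1..k. U j *
      (let conv = (\<lambda>z b. integral {0..b} (\<lambda>y. z \<gamma> (pos B - y) * of_real (\<psi>2 j y))) in vector
        [conv z4 (len B) / EI_damped B s,
         conv z3 (len B) / EI_damped B s,
         conv z2 (len B) / EI_damped B s,
         (conv z1 (len B) - beta B s * conv z4 (pos B)) / EI_damped B s] :: complex ^ 4) $ i)" for i
    by (intro sum.cong) (auto simp: r_column_def)
  note I = integral_zd_load[where u=0 and v="len B" and x="pos B" and U=U and n=0]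
    integral_zd_load[where u=0 and v="len B" and x="pos B" and U=U and n="Suc 0"]
    integral_zd_load[where u=0 and v="len B" and x="pos B" and U=U and n="Suc (Suc 0)"]
    integral_zd_load[where u=0 and v="len B" and x="pos B" and U=U and n="Suc (Suc (Suc 0))"]
    integral_zd_load[where u=0 and v="pos B" and x="pos B" and U=U and n=0]
  show "rhs U $ 1 = integral {0..len B} (\<lambda>y. zd \<gamma> 0 (pos B - y) * load U y)"
    "rhs U $ 2 = integral {0..len B} (\<lambda>y. zd \<gamma> (Suc 0) (pos B - y) * load U y)"
    "rhs U $ 3 = integral {0..len B} (\<lambda>y. zd \<gamma> (Suc (Suc 0)) (pos B - y) * load U y)"
    unfolding * col using I by (simp_all add: Let_def vector_4 r_column_def)
  have "rhs U $ 4 = U 0 / of_real (EI B) + (\<Sum>j=1..k.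
      U j * (integral {0..len B} (\<lambda>y. z1 \<gamma> (pos B - y) * of_real (\<psi>2 j y)) / EI_damped B s)
      - beta B s * (U j * (integral {0..pos B} (\<lambda>y. z4 \<gamma> (pos B - y) * of_real (\<psi>2 j y)) / EI_damped B s)))"
    unfolding * col by (simp add: Let_def vector_4 r_column_def diff_divide_distrib algebra_simps)
  then show "rhs U $ 4 = U 0 / of_real (EI B)
      + integral {0..len B} (\<lambda>y. zd \<gamma> (Suc (Suc (Suc 0))) (pos B - y) * load U y)
      - beta B s * integral {0..pos B} (\<lambda>y. zd \<gamma> 0 (pos B - y) * load U y)"
    using I pos_len by (simp add: sum_subtractf sum_distrib_left)
qed

lemma left_formula:
  assumes "beam_ode \<gamma> (load U) {0..v} W" "W 0 0 = 0" "W 2 0 = 0" "0 \<le> v" "n < 4"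
  shows "W n v = zd \<gamma> (Suc (Suc n)) v * W 1 0 + zd \<gamma> n v * W 3 0
    + integral {0..v} (\<lambda>y. zd \<gamma> n (v - y) * load U y)"
  using beam_ode_variation_of_constants(1)[OF \<gamma>_nz assms(1,4,5)] assms(2,3)
  by (simp add: sum_lessThan_4)

lemma right_formula:
  assumes "beam_ode \<gamma> (load U) {u..len B} W" "W 0 (len B) = 0" "W 2 (len B) = 0" "u \<le> len B" "n < 4"
  shows "W n u = zd \<gamma> (Suc (Suc n)) (u - len B) * W 1 (len B) + zd \<gamma> n (u - len B) * W 3 (len B)
    - integral {u..len B} (\<lambda>y. zd \<gamma> n (u - y) * load U y)"
  using beam_ode_variation_of_constants(2)[OF \<gamma>_nz assms(1,4,5)] assms(2,3)
  by (simp add: sum_lessThan_4)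

text \<open>Rows one to three say that the right value minus the left value at \<open>pos B\<close>
  is 0, with the load terms moved to the other side. The load integral enters \<open>L\<close> with
  a plus and \<open>R\<close> with a minus sign, so the two parts add up to one integral over the
  whole beam. Row four is the force balance divided by \<open>EI B\<close>; its term
  \<open>beta B s * L 0 (pos B)\<close> brings a load integral from the left part only, hence the
  extra term of \<open>rhs U $ 4\<close>.\<close>

lemma matching_conditions:
  assumes L: "beam_ode \<gamma> (load U) {0..len B} L" "L 0 0 = 0" "L 2 0 = 0" "L 1 0 = c $ 1" "L 3 0 = c $ 2"
    and R: "beam_ode \<gamma> (load U) {0..len B} R" "R 0 (len B) = 0" "R 2 (len B) = 0"
      "R 1 (len B) = c $ 3" "R 3 (len B) = c $ 4"
  shows "M_matrix B s \<gamma> *v c = rhs U \<longleftrightarrow>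
    L 0 (pos B) = R 0 (pos B) \<and> L 1 (pos B) = R 1 (pos B) \<and> L 2 (pos B) = R 2 (pos B) \<and>
    (of_real (mass B) * s\<^sup>2 + of_real (kappa B)) * L 0 (pos B)
      = of_real (EI B) * L 3 (pos B) - of_real (EI B) * R 3 (pos B) + U 0"
proof -
  let ?a = "pos B" and ?b = "pos B - len B"
  define I J where "I = (\<lambda>n. integral {0..pos B} (\<lambda>y. zd \<gamma> n (pos B - y) * load U y))"
    and "J = (\<lambda>n. integral {pos B..len B} (\<lambda>y. zd \<gamma> n (pos B - y) * load U y))"
  have Ln: "L n ?a = zd \<gamma> (Suc (Suc n)) ?a * c $ 1 + zd \<gamma> n ?a * c $ 2 + I n" if "n < 4" for n
    unfolding I_def L(4,5)[symmetric] using pos_len that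
    by (intro left_formula beam_ode_subset[OF L(1)] L(2,3)) auto
  have Rn: "R n ?a = zd \<gamma> (Suc (Suc n)) ?b * c $ 3 + zd \<gamma> n ?b * c $ 4 - J n" if "n < 4" for n
    unfolding J_def R(4,5)[symmetric] using pos_len that
    by (intro right_formula beam_ode_subset[OF R(1)] R(2,3)) auto
  have IJ: "integral {0..len B} (\<lambda>y. zd \<gamma> n (?a - y) * load U y) = I n + J n" for n
    unfolding I_def J_def using pos_len
    by (intro Henstock_Kurzweil_Integration.integral_combine[symmetric] set_lebesgue_integral_eq_integral(1)
        absolutely_integrable_continuous_mult zd_reflect_continuous \<gamma>_nz load_absolutely_integrable) auto
  have I0: "integral {0..pos B} (\<lambda>y. zd \<gamma> 0 (?a - y) * load U y) = I 0"
    by (simp only: I_def)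
  note vals = Ln[of 0] Ln[of "Suc 0"] Ln[of "Suc (Suc 0)"] Ln[of "Suc (Suc (Suc 0))"]
    Rn[of 0] Rn[of "Suc 0"] Rn[of "Suc (Suc 0)"] Rn[of "Suc (Suc (Suc 0))"]
  have 1: "(M_matrix B s \<gamma> *v c) $ 1 = rhs U $ 1 \<longleftrightarrow> L 0 ?a = R 0 ?a"
    unfolding rhs_components IJ using vals
    by (simp add: matrix_vector_mult_def sum_4 M_matrix_def Let_def vector_4) algebra
  have 2: "(M_matrix B s \<gamma> *v c) $ 2 = rhs U $ 2 \<longleftrightarrow> L 1 ?a = R 1 ?a"
    unfolding rhs_components IJ using vals
    by (simp add: matrix_vector_mult_def sum_4 M_matrix_def Let_def vector_4) algebra
  have 3: "(M_matrix B s \<gamma> *v c) $ 3 = rhs U $ 3 \<longleftrightarrow> L 2 ?a = R 2 ?a"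
    unfolding rhs_components IJ using vals
    by (simp add: matrix_vector_mult_def sum_4 M_matrix_def Let_def vector_4 numeral_2_eq_2) algebra
  have "(M_matrix B s \<gamma> *v c) $ 4 - rhs U $ 4 =
      beta B s * L 0 ?a - L 3 ?a + R 3 ?a - U 0 / of_real (EI B)"
    unfolding rhs_components IJ I0
    by (simp add: vals matrix_vector_mult_def sum_4 M_matrix_def Let_def vector_4 numeral_3_eq_3 algebra_simps)
  also have "\<dots> = ((of_real (mass B) * s\<^sup>2 + of_real (kappa B)) * L 0 ?a
      - (of_real (EI B) * L 3 ?a - of_real (EI B) * R 3 ?a + U 0)) / of_real (EI B)"
    using EI_nz by (simp add: beta_def field_simps)
  finally have 4: "(M_matrix B s \<gamma> *v c) $ 4 = rhs U $ 4 \<longleftrightarrow>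
    (of_real (mass B) * s\<^sup>2 + of_real (kappa B)) * L 0 ?a
      = of_real (EI B) * L 3 ?a - of_real (EI B) * R 3 ?a + U 0"
    using EI_nz by (metis right_minus_eq divide_eq_0_iff of_real_eq_0_iff)
  show ?thesis unfolding vec_eq_iff forall_4 using 1 2 3 4 by blast
qed

lemma transformed_system_beam_ode:
  assumes "transformed_system B k \<psi>2 s U W" "S \<in> {{0..<pos B}, {pos B<..len B}}" "{u..v} \<subseteq> S"
  shows "beam_ode \<gamma> (load U) {u..v} W"
  unfolding beam_ode_def
proof (intro conjI allI impI)
  note t = assms(1)[unfolded transformed_system_def]
  show "has_ac_derivative (W i) (W (Suc i)) {u..v}" if "i < 4" for i
    using beam_profile_has_ac_derivative[OF valid _ that assms(2,3)] t by blast
  have "AE x in lebesgue. x \<in> {0..<pos B} \<union> {pos B<..len B} \<longrightarrow>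
        EI_damped B s * W 4 x + of_real (rho B) * s\<^sup>2 * W 0 x = (\<Sum>j=1..k. of_real (\<psi>2 j x) * U j)"
    using t by blast
  then show "AE x in lebesgue. x \<in> {u..v} \<longrightarrow> W 4 x + 4 * \<gamma> ^ 4 * W 0 x = load U x"
  proof eventually_elim
    case (elim x)
    have "EI_damped B s * W 4 x + (4 * \<gamma> ^ 4 * EI_damped B s) * W 0 x = (\<Sum>j=1..k. of_real (\<psi>2 j x) * U j)"
      if "x \<in> {u..v}"
      using elim that assms(2,3) unfolding \<gamma>_power4 by blast
    then show ?case
      unfolding load_def using EI_damped_nz by (auto simp: eq_divide_eq algebra_simps)
  qed
qed

lemma ivp_solution:
  assumes "a \<in> {0..len B}"
  obtains L where "beam_ode \<gamma> (load U) {0..len B} L" "L 0 a = 0" "L 1 a = c" "L 2 a = 0" "L 3 a = d"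
proof -
  obtain L where "beam_ode \<gamma> (load U) {0..len B} L" "\<And>i. i < 4 \<Longrightarrow> L i a = [0, c, 0, d] ! i"
    using beam_ode_exists[OF \<gamma>_nz load_absolutely_integrable assms, of U "\<lambda>i. [0, c, 0, d] ! i"] by blast
  from this(1) this(2)[of 0] this(2)[of 1] this(2)[of 2] this(2)[of 3] show ?thesis
    by (intro that[of L]) (simp_all add: numeral_eq_Suc)
qed

text \<open>The equation for \<open>W\<close> is available only on closed intervals that avoid
  \<open>pos B\<close>. There \<open>W\<close> coincides with the continuations \<open>L\<close> and
  \<open>R\<close> that share its end data. Passing to the limit at \<open>pos B\<close> gives equal
  values up to order two, and for order three it identifies the one-sided limits in the force
  balance with \<open>L 3 (pos B)\<close> and \<open>R 3 (pos B)\<close>. The end data then solve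
  the linear system.\<close>

lemma transformed_system_output:
  assumes W: "transformed_system B k \<psi>2 s U W" and M: "invertible (M_matrix B s \<gamma>)"
    and x: "x \<in> {0..len B}"
  shows "W 2 x = (\<Sum>j=0..k. h_fun B \<psi>2 s \<gamma> j x * U j)"
proof -
  note t = W[unfolded transformed_system_def]
  note p = t[THEN conjunct1, unfolded beam_profile_def]
  have pl: "0 < pos B" "pos B < len B" by (fact pos_len)+
  obtain L where L: "beam_ode \<gamma> (load U) {0..len B} L" "L 0 0 = 0" "L 1 0 = W 1 0" "L 2 0 = 0" "L 3 0 = W 3 0"
    using ivp_solution[of 0 U "W 1 0" "W 3 0"] pl by auto
  obtain R where R: "beam_ode \<gamma> (load U) {0..len B} R" "R 0 (len B) = 0" "R 1 (len B) = W 1 (len B)"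
      "R 2 (len B) = 0" "R 3 (len B) = W 3 (len B)"
    using ivp_solution[of "len B" U "W 1 (len B)" "W 3 (len B)"] pl by auto
  have WL: "W n y = L n y" if "y \<in> {0..<pos B}" "n < 4" for n y
  proof (rule beam_ode_unique[OF \<gamma>_nz _ _ _ _ _ that(2)])
    show "beam_ode \<gamma> (load U) {0..y} W"
      by (rule transformed_system_beam_ode[OF W, of "{0..<pos B}"]) (use that in auto)
    show "beam_ode \<gamma> (load U) {0..y} L"
      by (rule beam_ode_subset[OF L(1)]) (use that pl in auto)
    show "W i 0 = L i 0" if "i < 4" for i
    proof -
      consider "i = 0" | "i = 1" | "i = 2" | "i = 3" using \<open>i < 4\<close> by linarith
      then show ?thesis using L t by cases simp_all
    qed
  qed (use that in auto)
  have WR: "W n y = R n y" if "y \<in> {pos B<..len B}" "n < 4" for n y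
  proof (rule beam_ode_unique[OF \<gamma>_nz _ _ _ _ _ that(2)])
    show "beam_ode \<gamma> (load U) {y..len B} W"
      by (rule transformed_system_beam_ode[OF W, of "{pos B<..len B}"]) (use that in auto)
    show "beam_ode \<gamma> (load U) {y..len B} R"
      by (rule beam_ode_subset[OF R(1)]) (use that pl in auto)
    show "W i (len B) = R i (len B)" if "i < 4" for i
    proof -
      consider "i = 0" | "i = 1" | "i = 2" | "i = 3" using \<open>i < 4\<close> by linarith
      then show ?thesis using R t by cases simp_all
    qed
  qed (use that in auto)
  have tL: "(W n \<longlongrightarrow> L n (pos B)) (at_left (pos B))" if "n < 4" for n
    by (rule tendsto_at_left_of_eq[OF beam_ode_continuous[OF L(1) that]]) (use pl WL that in auto)
  have tR: "(W n \<longlongrightarrow> R n (pos B)) (at_right (pos B))" if "n < 4" for n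
    by (rule tendsto_at_right_of_eq[OF beam_ode_continuous[OF R(1) that]]) (use pl WR that in auto)
  have d0: "\<And>x. x \<in> {0..len B} \<Longrightarrow> (W 0 has_vector_derivative W 1 x) (at x within {0..len B})"
    and d1: "\<And>x. x \<in> {0..len B} \<Longrightarrow> (W 1 has_vector_derivative W 2 x) (at x within {0..len B})"
    and c2: "continuous_on {0..len B} (W 2)"
    using p by blast+
  have "continuous_on {0..len B} (W n)" if "n < 3" for n
  proof -
    consider "n = 0" | "n = 1" | "n = 2" using \<open>n < 3\<close> by linarith
    then show ?thesis
      using continuous_on_vector_derivative[OF d0] continuous_on_vector_derivative[OF d1] c2
      by cases simp_all
  qed
  then have tWL: "(W n \<longlongrightarrow> W n (pos B)) (at_left (pos B))"
    and tWR: "(W n \<longlongrightarrow> W n (pos B)) (at_right (pos B))" if "n < 3" for n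
    using that pl tendsto_at_left_of_eq[of 0 "len B" "W n" "pos B" "W n"]
      tendsto_at_right_of_eq[of 0 "len B" "W n" "pos B" "W n"] by simp_all
  \<comment> \<open>Uniqueness of limits: \<open>W n\<close> is continuous across
    \<open>pos B\<close> and is also the continuation on either side.\<close>
  have eq: "W n (pos B) = L n (pos B)" "W n (pos B) = R n (pos B)" if "n < 3" for n
    using tendsto_unique[OF trivial_limit_at_left_real tWL[OF that] tL[of n]]
      tendsto_unique[OF trivial_limit_at_right_real tWR[OF that] tR[of n]] that by simp_all
  have lim: "Lim (at_left (pos B)) (W 3) = L 3 (pos B)" "Lim (at_right (pos B)) (W 3) = R 3 (pos B)"
    using tL[of 3] tR[of 3] by (auto intro!: tendsto_Lim)
  define c :: "complex ^ 4" where "c = vector [W 1 0, W 3 0, W 1 (len B), W 3 (len B)]"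
  have "M_matrix B s \<gamma> *v c = rhs U"
    using matching_conditions[OF L(1,2,4) _ _ R(1,2,4), of c] L R t lim eq[of 0] eq[of 1] eq[of 2]
    by (simp add: c_def vector_4)
  then have c: "coeff U = c"
    unfolding coeff_def using M
    by (metis invertible_matrix_inv(2) matrix_vector_mul_assoc matrix_vector_mul_lid)
  \<comment> \<open>The attachment point belongs to the left branch, as in \<open>h_fun\<close>;
    there the value comes from the limit argument rather than from the comparison on a half.\<close>
  have W2: "W 2 x = (if x \<le> pos B then L 2 x else R 2 x)"
    using WL[of x 2] WR[of x 2] eq[of 2] x by (cases "x = pos B") auto
  show ?thesis
  proof (cases "x \<le> pos B")
    case True
    have "L 2 x = zd \<gamma> (Suc (Suc 2)) x * L 1 0 + zd \<gamma> 2 x * L 3 0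
      + integral {0..x} (\<lambda>y. zd \<gamma> 2 (x - y) * load U y)"
      by (rule left_formula[OF beam_ode_subset[OF L(1)]]) (use L x in auto)
    also have "integral {0..x} (\<lambda>y. zd \<gamma> 2 (x - y) * load U y) = (\<Sum>j=1..k. U j *
      (integral {0..x} (\<lambda>y. zd \<gamma> 2 (x - y) * of_real (\<psi>2 j y)) / EI_damped B s))"
      by (rule integral_zd_load) (use x in auto)
    finally show ?thesis
      using True W2 unfolding sum_h_fun c by (simp add: c_def vector_4 L L(3)[unfolded One_nat_def] numeral_2_eq_2)
  next
    case False
    have "R 2 x = zd \<gamma> (Suc (Suc 2)) (x - len B) * R 1 (len B) + zd \<gamma> 2 (x - len B) * R 3 (len B)
      - integral {x..len B} (\<lambda>y. zd \<gamma> 2 (x - y) * load U y)"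
      by (rule right_formula[OF beam_ode_subset[OF R(1)]]) (use R x in auto)
    also have "integral {x..len B} (\<lambda>y. zd \<gamma> 2 (x - y) * load U y) = (\<Sum>j=1..k. U j *
      (integral {x..len B} (\<lambda>y. zd \<gamma> 2 (x - y) * of_real (\<psi>2 j y)) / EI_damped B s))"
      by (rule integral_zd_load) (use x in auto)
    finally show ?thesis
      using False W2 unfolding sum_h_fun c by (simp add: c_def vector_4 R R(3)[unfolded One_nat_def] numeral_2_eq_2)
  qed
qed

text \<open>The matching conditions are read backwards: a solution of the linear system supplies end
  data at both ends, three of the resulting matches make the glued function twice continuously
  differentiable, and the fourth is the force balance.\<close>

lemma transformed_system_exists:
  assumes M: "invertible (M_matrix B s \<gamma>)"
  shows "\<exists>W. transformed_system B k \<psi>2 s U W"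
proof -
  have pl: "0 < pos B" "pos B < len B" by (fact pos_len)+
  define c where "c = coeff U"
  have Mc: "M_matrix B s \<gamma> *v c = rhs U"
    unfolding c_def coeff_def using M
    by (metis invertible_matrix_inv(1) matrix_vector_mul_assoc matrix_vector_mul_lid)
  obtain L where L: "beam_ode \<gamma> (load U) {0..len B} L" "L 0 0 = 0" "L 1 0 = c $ 1" "L 2 0 = 0" "L 3 0 = c $ 2"
    using ivp_solution[of 0 U "c $ 1" "c $ 2"] pl by auto
  obtain R where R: "beam_ode \<gamma> (load U) {0..len B} R" "R 0 (len B) = 0" "R 1 (len B) = c $ 3"
      "R 2 (len B) = 0" "R 3 (len B) = c $ 4"
    using ivp_solution[of "len B" U "c $ 3" "c $ 4"] pl by auto
  have match: "L 0 (pos B) = R 0 (pos B)" "L 1 (pos B) = R 1 (pos B)" "L 2 (pos B) = R 2 (pos B)"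
    "(of_real (mass B) * s\<^sup>2 + of_real (kappa B)) * L 0 (pos B)
      = of_real (EI B) * L 3 (pos B) - of_real (EI B) * R 3 (pos B) + U 0"
    using matching_conditions[OF L(1,2,4,3,5) R(1,2,4,3,5)] Mc by blast+
  \<comment> \<open>Up to order two both branches agree at \<open>pos B\<close>. For
    \<open>W 3\<close> and \<open>W 4\<close> the left branch merely supplies a default value at a
    point outside both halves of \<open>beam_profile\<close>.\<close>
  define W where "W = (\<lambda>n x. if x \<in> {0..pos B} then L n x else R n x)"
  have un: "{0..len B} = {0..pos B} \<union> {pos B..len B}" using pl by auto
  have int: "{0..pos B} \<inter> {pos B..len B} = {pos B}" using pl by auto
  have acL: "has_ac_derivative (L n) (L (Suc n)) {0..len B}" if "n < 4" for n
    using L(1) that by (simp add: beam_ode_def)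
  have acR: "has_ac_derivative (R n) (R (Suc n)) {0..len B}" if "n < 4" for n
    using R(1) that by (simp add: beam_ode_def)
  have dL: "(L n has_vector_derivative L (Suc n) x) (at x within S)"
    if "n < 3" "x \<in> {0..len B}" "S \<subseteq> {0..len B}" for n x S
    by (rule has_vector_derivative_within_subset[OF beam_ode_has_vector_derivative[OF L(1) that(1,2)] that(3)])
  have dR: "(R n has_vector_derivative R (Suc n) x) (at x within S)"
    if "n < 3" "x \<in> {0..len B}" "S \<subseteq> {0..len B}" for n x S
    by (rule has_vector_derivative_within_subset[OF beam_ode_has_vector_derivative[OF R(1) that(1,2)] that(3)])
  have dW: "(W n has_vector_derivative W (Suc n) x) (at x within {0..len B})"
    if "n < 2" "x \<in> {0..len B}" for n x
  proof -
    have m: "L n (pos B) = R n (pos B)" "L (Suc n) (pos B) = R (Suc n) (pos B)"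
      using that(1) match by (auto simp: less_Suc_eq numeral_2_eq_2)
    \<comment> \<open>The closed pieces meet in one point, so agreement of values and of derivatives
      has to be checked there alone.\<close>
    have cl: "closure {0..pos B} \<inter> closure {pos B..len B} = {pos B}" using int by simp
    have absorb: "{0..pos B} \<union> {pos B} = {0..pos B}" "{pos B..len B} \<union> {pos B} = {pos B..len B}"
      using pl by auto
    show ?thesis
      unfolding W_def
    proof (rule has_vector_derivative_If_within_closures[where S="{0..pos B}" and T="{pos B..len B}"];
        (unfold cl absorb)?)
      show "x \<in> {0..pos B} \<union> {pos B..len B}" using that un by simp
      show "{0..len B} = {0..pos B} \<union> {pos B..len B}" by (fact un)
      show "(L n has_vector_derivative L (Suc n) x) (at x within {0..pos B})" if "x \<in> {0..pos B}"
        by (rule dL) (use \<open>n < 2\<close> that pl in auto)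
      show "(R n has_vector_derivative R (Suc n) x) (at x within {pos B..len B})" if "x \<in> {pos B..len B}"
        by (rule dR) (use \<open>n < 2\<close> that pl in auto)
      show "L n x = R n x" "L (Suc n) x = R (Suc n) x" if "x \<in> closure {0..pos B}" "x \<in> closure {pos B..len B}"
      proof -
        have "x = pos B" using that by simp
        then show "L n x = R n x" "L (Suc n) x = R (Suc n) x" using m by simp_all
      qed
    qed
  qed
  have c2: "continuous_on {0..len B} (W 2)"
    unfolding W_def un
  proof (rule continuous_on_cases)
    show "continuous_on {0..pos B} (L 2)" "continuous_on {pos B..len B} (R 2)"
      by (rule continuous_on_subset[OF beam_ode_continuous[OF L(1)]]
          continuous_on_subset[OF beam_ode_continuous[OF R(1)]]; use pl in auto)+
    show "\<forall>x. x \<in> {0..pos B} \<and> x \<notin> {0..pos B} \<or> x \<in> {pos B..len B} \<and> x \<in> {0..pos B} \<longrightarrow> L 2 x = R 2 x"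
      using match(3) int by force
  qed auto
  have eqL: "W n y = L n y" if "y \<in> {0..<pos B}" for n y using that by (simp add: W_def)
  have eqR: "W n y = R n y" if "y \<in> {pos B<..len B}" for n y using that by (simp add: W_def)
  have "beam_profile B W"
    unfolding beam_profile_def
  proof (intro conjI ballI)
    show "(W 0 has_vector_derivative W 1 x) (at x within {0..len B})"
      "(W 1 has_vector_derivative W 2 x) (at x within {0..len B})" if "x \<in> {0..len B}" for x
      using dW[of 0 x] dW[of 1 x] that by (simp_all add: numeral_2_eq_2)
    show "continuous_on {0..len B} (W 2)" by (fact c2)
    fix S assume S: "S \<in> {{0..<pos B}, {pos B<..len B}}"
    \<comment> \<open>\<open>K\<close> is whichever continuation equals \<open>W\<close> on
      \<open>S\<close>. Being regular over the whole beam, it settles integrability up to the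
      missing end point of \<open>S\<close>.\<close>
    obtain K where K: "K = L \<or> K = R" "\<And>n y. y \<in> S \<Longrightarrow> W n y = K n y"
      using S eqL eqR by blast
    have sub: "S \<subseteq> {0..len B}" "S \<in> sets lebesgue" "\<And>x y. x \<in> S \<Longrightarrow> y \<in> S \<Longrightarrow> {x..y} \<subseteq> S"
      using S pl by auto
    show "(W 2 has_vector_derivative W 3 x) (at x within S)" if "x \<in> S" for x
    proof -
      have "(K 2 has_vector_derivative K 3 x) (at x within S)"
        using K(1) dL[of 2 x S] dR[of 2 x S] that sub(1) by (auto simp: numeral_eq_Suc)
      then show ?thesis
        using has_vector_derivative_transform[of x S "W 2" "K 2"] K(2) that by simp
    qed
    have "has_ac_derivative (K 3) (K 4) {0..len B}"
      using K(1) acL[of 3] acR[of 3] by (auto simp: numeral_eq_Suc)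
    then have "has_ac_derivative (K 3) (K 4) S"
      using sub has_ac_derivative_mono by blast
    then show "has_ac_derivative (W 3) (W 4) S"
      by (rule has_ac_derivative_cong) (use K(2) sub in auto)
  qed
  moreover have "AE x in lebesgue. x \<in> {0..<pos B} \<union> {pos B<..len B} \<longrightarrow>
        EI_damped B s * W 4 x + of_real (rho B) * s\<^sup>2 * W 0 x = (\<Sum>j=1..k. of_real (\<psi>2 j x) * U j)"
  proof -
    have "AE x in lebesgue. x \<in> {0..len B} \<longrightarrow> L 4 x + 4 * \<gamma> ^ 4 * L 0 x = load U x"
      "AE x in lebesgue. x \<in> {0..len B} \<longrightarrow> R 4 x + 4 * \<gamma> ^ 4 * R 0 x = load U x"
      using L(1) R(1) unfolding beam_ode_def by blast+
    then show ?thesis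
    proof eventually_elim
      case (elim x)
      have "W 4 x + 4 * \<gamma> ^ 4 * W 0 x = load U x" if "x \<in> {0..<pos B} \<union> {pos B<..len B}"
        using that elim pl by (auto simp: eqL eqR)
      then show ?case
        unfolding \<gamma>_power4[symmetric] load_def using EI_damped_nz by (auto simp: eq_divide_eq algebra_simps)
    qed
  qed
  moreover have "W 0 0 = 0" "W 0 (len B) = 0" "W 2 0 = 0" "W 2 (len B) = 0" "W 0 (pos B) = L 0 (pos B)"
    using L R pl by (auto simp: W_def)
  moreover have "Lim (at_left (pos B)) (W 3) = L 3 (pos B)"
    using tendsto_at_left_of_eq[OF beam_ode_continuous[OF L(1)], of 3 "pos B" "W 3"] pl eqL
    by (auto intro!: tendsto_Lim)
  moreover have "Lim (at_right (pos B)) (W 3) = R 3 (pos B)"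
    using tendsto_at_right_of_eq[OF beam_ode_continuous[OF R(1)], of 3 "pos B" "W 3"] pl eqR
    by (auto intro!: tendsto_Lim)
  ultimately have "transformed_system B k \<psi>2 s U W"
    unfolding transformed_system_def using match(4) by simp
  then show ?thesis by blast
qed

end

section \<open>The Laplace transform of the control system\<close>

lemma laplace_cong:
  "(\<And>t. t \<ge> 0 \<Longrightarrow> f t = g t) \<Longrightarrow> laplace f s = laplace g s"
  unfolding laplace_def by (intro Henstock_Kurzweil_Integration.integral_cong) auto

lemma laplace_exists_cong:
  assumes "\<And>t. t \<ge> 0 \<Longrightarrow> f t = g t" "laplace_exists f s"
  shows "laplace_exists g s"
  using assms(2) unfolding laplace_exists_def
  by (rule absolutely_integrable_spike[where S="{}"]) (use assms(1) in auto)

lemma laplace_exists_has_integral: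
  "laplace_exists f s \<Longrightarrow>
    ((\<lambda>t. of_real (f t) * exp (- s * of_real t)) has_integral laplace f s) {0..}"
  unfolding laplace_exists_def laplace_def
  by (intro integrable_integral set_lebesgue_integral_eq_integral(1))

lemma laplace_add:
  assumes "laplace_exists f s" "laplace_exists g s"
  shows "laplace_exists (\<lambda>t. f t + g t) s" "laplace (\<lambda>t. f t + g t) s = laplace f s + laplace g s"
proof -
  have eq: "(\<lambda>t. complex_of_real (f t + g t) * exp (- s * of_real t))
    = (\<lambda>t. of_real (f t) * exp (- s * of_real t) + of_real (g t) * exp (- s * of_real t))"
    by (simp add: fun_eq_iff distrib_right)
  show "laplace_exists (\<lambda>t. f t + g t) s"
    using assms unfolding laplace_exists_def eq by (rule set_integral_add(1))
  show "laplace (\<lambda>t. f t + g t) s = laplace f s + laplace g s"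
    unfolding laplace_def[of "\<lambda>t. f t + g t"] eq
    by (intro integral_unique has_integral_add laplace_exists_has_integral assms)
qed

lemma laplace_cmult:
  assumes "laplace_exists f s"
  shows "laplace_exists (\<lambda>t. c * f t) s" "laplace (\<lambda>t. c * f t) s = of_real c * laplace f s"
proof -
  have eq: "(\<lambda>t. complex_of_real (c * f t) * exp (- s * of_real t))
    = (\<lambda>t. of_real c * (of_real (f t) * exp (- s * of_real t)))"
    by (simp add: fun_eq_iff)
  show "laplace_exists (\<lambda>t. c * f t) s"
    using absolutely_integrable_linear[OF assms[unfolded laplace_exists_def] bounded_linear_mult_right[of "of_real c"]]
    unfolding laplace_exists_def eq by (simp add: comp_def)
  show "laplace (\<lambda>t. c * f t) s = of_real c * laplace f s"
    unfolding laplace_def[of "\<lambda>t. c * f t"] eq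
    by (intro integral_unique has_integral_mult_right laplace_exists_has_integral assms)
qed

lemma laplace_diff:
  assumes "laplace_exists f s" "laplace_exists g s"
  shows "laplace_exists (\<lambda>t. f t - g t) s" "laplace (\<lambda>t. f t - g t) s = laplace f s - laplace g s"
  using laplace_add[OF assms(1) laplace_cmult(1)[OF assms(2), of "-1"]] laplace_cmult(2)[OF assms(2), of "-1"]
  by simp_all

lemma laplace_zero: "laplace_exists (\<lambda>_. 0) s" "laplace (\<lambda>_. 0) s = 0"
  by (simp_all add: laplace_exists_def laplace_def set_integrable_def)

lemma laplace_sum:
  assumes "\<And>j. j \<in> J \<Longrightarrow> laplace_exists (f j) s"
  shows "laplace_exists (\<lambda>t. \<Sum>j\<in>J. f j t) s \<and> laplace (\<lambda>t. \<Sum>j\<in>J. f j t) s = (\<Sum>j\<in>J. laplace (f j) s)"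
  using assms
proof (induction J rule: infinite_finite_induct)
  case (insert j J)
  then show ?case using laplace_add[of "f j" s "\<lambda>t. \<Sum>j\<in>J. f j t"] by simp
qed (auto simp: laplace_zero)

text \<open>Integration by parts in the form: the derivative of \<open>f t * exp (- s * t)\<close>
  integrates to its boundary terms. For the gauge integral the fundamental theorem asks only that
  \<open>f'\<close> be a derivative, not that it be continuous; absolute integrability then
  identifies the gauge integral with the Lebesgue integral.\<close>

lemma laplace_derivative:
  fixes f f' :: "real \<Rightarrow> real"
  assumes deriv: "\<And>t. t \<ge> 0 \<Longrightarrow> (f has_vector_derivative f' t) (at t within {0..})"
    and bound: "\<And>t. t \<ge> 0 \<Longrightarrow> \<bar>f t\<bar> \<le> C * exp (\<sigma> * t)" and \<sigma>: "\<sigma> < Re s"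
    and ex: "laplace_exists f s" "laplace_exists f' s" and f0: "f 0 = 0"
  shows "laplace f' s = s * laplace f s"
proof -
  define F where "F = (\<lambda>t. complex_of_real (f t) * exp (- s * of_real t))"
  define F' where "F' = (\<lambda>t. complex_of_real (f' t) * exp (- s * of_real t)
    - s * (of_real (f t) * exp (- s * of_real t)))"
  have "(\<lambda>t. s * (complex_of_real (f t) * exp (- s * of_real t))) absolutely_integrable_on {0..}"
    using absolutely_integrable_linear[OF ex(1)[unfolded laplace_exists_def] bounded_linear_mult_right[of s]]
    by (simp add: comp_def)
  then have F'_int: "F' absolutely_integrable_on {0..}"
    unfolding F'_def using ex(2)[unfolded laplace_exists_def] by (intro set_integral_diff(1))
  have "(F' has_integral laplace f' s - s * laplace f s) {0..}"
    unfolding F'_def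
    by (intro has_integral_diff has_integral_mult_right laplace_exists_has_integral ex)
  then have val: "integral {0..} F' = laplace f' s - s * laplace f s" by (rule integral_unique)
  have dF: "(F has_vector_derivative F' t) (at t within {0..})" if "t \<ge> 0" for t
  proof -
    have "((\<lambda>t. complex_of_real (f t)) has_vector_derivative of_real (f' t)) (at t within {0..})"
      by (rule bounded_linear.has_vector_derivative[OF bounded_linear_of_real deriv[OF that]])
    moreover have "((\<lambda>t. exp (- s * of_real t)) has_vector_derivative - s * exp (- s * of_real t)) (at t within {0..})"
      by (rule has_vector_derivative_real_field) (auto intro!: derivative_eq_intros)
    ultimately have "(F has_vector_derivative of_real (f t) * (- s * exp (- s * of_real t))
        + of_real (f' t) * exp (- s * of_real t)) (at t within {0..})"
      unfolding F_def by (rule has_vector_derivative_mult)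
    then show ?thesis by (simp add: F'_def algebra_simps)
  qed
  have FTC: "set_lebesgue_integral lebesgue {0..b} F' = F b" if "b \<ge> 0" for b
  proof -
    have "F' absolutely_integrable_on {0..b}"
      by (rule absolutely_integrable_on_subinterval[OF F'_int]) auto
    then have "set_lebesgue_integral lebesgue {0..b} F' = integral {0..b} F'"
      by (rule set_lebesgue_integral_eq_integral(2))
    also have "(F' has_integral F b - F 0) {0..b}"
      using that by (intro fundamental_theorem_of_calculus)
        (auto intro!: has_vector_derivative_within_subset[OF dF])
    then have "integral {0..b} F' = F b" using f0 by (simp add: F_def integral_unique)
    finally show ?thesis .
  qed
  have "((\<lambda>b. set_lebesgue_integral lebesgue {0..b} F') \<longlongrightarrow> set_lebesgue_integral lebesgue {0..} F') at_top"
    by (rule tendsto_set_lebesgue_integral_at_top) (use F'_int in auto)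
  \<comment> \<open>The truncated integrals are the values \<open>F b\<close>, so the integral over
    the half-line is the boundary term at infinity, which the growth bound forces to be 0.\<close>
  then have "(F \<longlongrightarrow> set_lebesgue_integral lebesgue {0..} F') at_top"
    by (rule Lim_transform_eventually) (use FTC in \<open>auto intro: eventually_mono[OF eventually_ge_at_top[of 0]]\<close>)
  moreover have "(F \<longlongrightarrow> 0) at_top"
  proof (rule Lim_null_comparison)
    show "\<forall>\<^sub>F t in at_top. norm (F t) \<le> C * exp (- (Re s - \<sigma>) * t)"
      using eventually_ge_at_top[of 0]
    proof eventually_elim
      case (elim t)
      have "norm (F t) = \<bar>f t\<bar> * exp (- Re s * t)" by (simp add: F_def norm_mult norm_exp_eq_Re)
      also have "\<dots> \<le> C * exp (\<sigma> * t) * exp (- Re s * t)" using bound[OF elim] by (intro mult_right_mono) auto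
      also have "\<dots> = C * exp (- (Re s - \<sigma>) * t)" by (simp add: exp_add[symmetric] algebra_simps)
      finally show ?case .
    qed
    have "filterlim (\<lambda>t. - (Re s - \<sigma>) * t) at_bot at_top"
      using \<sigma> by (intro filterlim_tendsto_neg_mult_at_bot[OF tendsto_const]) (auto simp: filterlim_ident)
    then have "((\<lambda>t. exp (- (Re s - \<sigma>) * t)) \<longlongrightarrow> 0) at_top"
      by (rule filterlim_compose[OF exp_at_bot])
    then show "((\<lambda>t. C * exp (- (Re s - \<sigma>) * t)) \<longlongrightarrow> 0) at_top"
      by (rule tendsto_mult_right_zero)
  qed
  ultimately have "set_lebesgue_integral lebesgue {0..} F' = 0"
    using tendsto_unique[OF trivial_limit_at_top_linorder] by blast
  then show ?thesis
    using val set_lebesgue_integral_eq_integral(2)[OF F'_int] by simp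
qed

section \<open>Fubini's theorem for exponentially dominated functions\<close>

locale laplace_dominated =
  fixes B :: beam and \<sigma> :: real and g :: "real \<Rightarrow> real" and s :: complex
  assumes \<sigma>: "\<sigma> < Re s" and g: "g absolutely_integrable_on {0..len B}"
begin

lemma section_t_measurable:
  assumes "exp_dominated B \<sigma> g f" "x \<in> {0..len B}"
  shows "(\<lambda>t. indicator {0..} t *\<^sub>R f x t) \<in> borel_measurable borel"
proof -
  have "(\<lambda>z. indicator ({0..len B} \<times> {0..}) z *\<^sub>R (\<lambda>(x, t). f x t) z) \<in> borel_measurable (borel \<Otimes>\<^sub>M borel)"
    using assms(1) unfolding exp_dominated_def set_borel_measurable_def borel_prod by blast
  from measurable_compose[OF measurable_Pair1' this, of x] show ?thesis
    using assms(2) by (simp add: indicator_times)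
qed

lemma section_x_measurable:
  assumes "exp_dominated B \<sigma> g f" "t \<ge> 0"
  shows "(\<lambda>x. indicator {0..len B} x *\<^sub>R f x t) \<in> borel_measurable borel"
proof -
  have "(\<lambda>z. indicator ({0..len B} \<times> {0..}) z *\<^sub>R (\<lambda>(x, t). f x t) z) \<in> borel_measurable (borel \<Otimes>\<^sub>M borel)"
    using assms(1) unfolding exp_dominated_def set_borel_measurable_def borel_prod by blast
  from measurable_compose[OF measurable_Pair2' this, of t] show ?thesis
    using assms(2) by (simp add: indicator_times)
qed

text \<open>The cut-offs turn both iterated integrals into integrals over the whole line, so that
  Fubini's theorem for \<open>lborel\<close> applies.\<close>

definition kernel :: "(real \<Rightarrow> real \<Rightarrow> real) \<Rightarrow> real \<Rightarrow> real \<Rightarrow> real \<times> real \<Rightarrow> complex" where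
  "kernel f a b = (\<lambda>(x, t). indicator {a..b} x *\<^sub>R indicator {0..} t *\<^sub>R (of_real (f x t) * exp (- s * of_real t)))"

lemma kernel_measurable:
  assumes "exp_dominated B \<sigma> g f" "{a..b} \<subseteq> {0..len B}"
  shows "kernel f a b \<in> borel_measurable (borel \<Otimes>\<^sub>M borel)"
proof -
  have [measurable]: "(\<lambda>z. indicator ({0..len B} \<times> {0..}) z *\<^sub>R (\<lambda>(x, t). f x t) z) \<in> borel_measurable (borel \<Otimes>\<^sub>M borel)"
    using assms(1) unfolding exp_dominated_def set_borel_measurable_def borel_prod by blast
  have "(\<lambda>z. indicator {a..b} (fst z) *\<^sub>R (complex_of_real (indicator ({0..len B} \<times> {0..}) z *\<^sub>R (\<lambda>(x, t). f x t) z)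
      * exp (- s * of_real (snd z)))) \<in> borel_measurable (borel \<Otimes>\<^sub>M borel)"
    by measurable
  moreover have "kernel f a b z = indicator {a..b} (fst z) *\<^sub>R (complex_of_real (indicator ({0..len B} \<times> {0..}) z *\<^sub>R (\<lambda>(x, t). f x t) z)
      * exp (- s * of_real (snd z)))" for z
    using assms(2) by (cases z) (auto simp: kernel_def indicator_def)
  ultimately show ?thesis by (metis (no_types, lifting) measurable_cong)
qed

lemma norm_laplace_integrand:
  assumes "exp_dominated B \<sigma> g f" "x \<in> {0..len B}" "t \<ge> 0"
  shows "norm (of_real (f x t) * exp (- s * of_real t)) \<le> g x * exp (- (Re s - \<sigma>) * t)"
proof -
  have "norm (of_real (f x t) * exp (- s * of_real t)) = \<bar>f x t\<bar> * exp (- Re s * t)"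
    by (simp add: norm_mult norm_exp_eq_Re)
  also have "\<dots> \<le> g x * exp (\<sigma> * t) * exp (- Re s * t)"
    using assms unfolding exp_dominated_def by (intro mult_right_mono) auto
  also have "\<dots> = g x * exp (- (Re s - \<sigma>) * t)" by (simp add: exp_add[symmetric] algebra_simps)
  finally show ?thesis .
qed

lemma laplace_exists_dominated:
  assumes "exp_dominated B \<sigma> g f" "x \<in> {0..len B}"
  shows "laplace_exists (f x) s"
  unfolding laplace_exists_def
proof (rule measurable_bounded_by_integrable_imp_absolutely_integrable)
  have [measurable]: "(\<lambda>t. indicator {0..} t *\<^sub>R f x t) \<in> borel_measurable borel"
    by (rule section_t_measurable[OF assms])
  have "(\<lambda>t. complex_of_real (indicator {0..} t *\<^sub>R f x t) * exp (- s * of_real t)) \<in> borel_measurable borel"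
    by measurable
  then have "(\<lambda>t. indicator {0..} t *\<^sub>R (complex_of_real (f x t) * exp (- s * of_real t))) \<in> borel_measurable borel"
    by (simp add: scaleR_conv_of_real mult.assoc)
  then have "(\<lambda>t. indicator {0..} t *\<^sub>R (complex_of_real (f x t) * exp (- s * of_real t))) \<in> borel_measurable lebesgue"
    by (intro measurable_completion) simp
  then show "(\<lambda>t. complex_of_real (f x t) * exp (- s * of_real t)) \<in> borel_measurable (lebesgue_on {0..})"
    by (subst borel_measurable_restrict_space_iff) auto
  show "(\<lambda>t. g x * exp (- (Re s - \<sigma>) * t)) integrable_on {0..}"
    using \<sigma> by (intro integrable_on_mult_right integrable_on_exp_minus_to_infinity) simp
qed (use norm_laplace_integrand[OF assms] in auto)

lemma section_absolutely_integrable: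
  assumes "exp_dominated B \<sigma> g f" "t \<ge> 0"
  shows "(\<lambda>x. f x t) absolutely_integrable_on {0..len B}"
proof (rule measurable_bounded_by_integrable_imp_absolutely_integrable)
  have "(\<lambda>x. indicator {0..len B} x *\<^sub>R f x t) \<in> borel_measurable lebesgue"
    using section_x_measurable[OF assms] by (intro measurable_completion) simp
  then show "(\<lambda>x. f x t) \<in> borel_measurable (lebesgue_on {0..len B})"
    by (subst borel_measurable_restrict_space_iff) auto
  show "(\<lambda>x. g x * exp (\<sigma> * t)) integrable_on {0..len B}"
    using g by (intro integrable_on_mult_left set_lebesgue_integral_eq_integral(1))
qed (use assms in \<open>auto simp: exp_dominated_def\<close>)

text \<open>The first and third facts feed the integrability criterion on the product space, the
  second evaluates the inner integral. The constant in the third is the integral of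
  \<open>exp (- (Re s - \<sigma>) * t)\<close> over the half-line.\<close>

lemma kernel_section_t:
  assumes f: "exp_dominated B \<sigma> g f" and ab: "{a..b} \<subseteq> {0..len B}"
  shows "integrable lborel (\<lambda>t. kernel f a b (x, t))"
    and "(\<integral>t. kernel f a b (x, t) \<partial>lborel) = indicator {a..b} x *\<^sub>R laplace (f x) s"
    and "(\<integral>t. norm (kernel f a b (x, t)) \<partial>lborel) \<le> indicator {a..b} x *\<^sub>R (g x / (Re s - \<sigma>))"
proof -
  have m: "(\<lambda>t. kernel f a b (x, t)) \<in> borel_measurable lborel"
    using measurable_compose[OF measurable_Pair1' kernel_measurable[OF f ab], of x] by simp
  have k: "kernel f a b (x, t) = indicator {0..} t *\<^sub>R (of_real (f x t) * exp (- s * of_real t))"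
    if "x \<in> {a..b}" for t
    using that by (simp add: kernel_def)
  have ex: "(\<lambda>t. of_real (f x t) * exp (- s * of_real t)) absolutely_integrable_on {0..}" if "x \<in> {a..b}"
    using laplace_exists_dominated[OF f] that ab unfolding laplace_exists_def by blast
  \<comment> \<open>Gauge integrals correspond to integrals over \<open>lebesgue\<close>, Fubini's
    theorem is used over \<open>lborel\<close>; Borel measurability of the kernel lets the value
    pass between the two.\<close>
  have i: "integrable lebesgue (\<lambda>t. kernel f a b (x, t))"
  proof (cases "x \<in> {a..b}")
    case True
    show ?thesis using ex[OF True] unfolding k[OF True] set_integrable_def .
  next
    case False
    then show ?thesis by (simp add: kernel_def)
  qed
  then show i': "integrable lborel (\<lambda>t. kernel f a b (x, t))"
    using m by (simp add: integrable_completion)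
  have "(\<integral>t. kernel f a b (x, t) \<partial>lebesgue) = indicator {a..b} x *\<^sub>R laplace (f x) s"
  proof (cases "x \<in> {a..b}")
    case True
    have "(\<integral>t. kernel f a b (x, t) \<partial>lebesgue) = laplace (f x) s"
      using set_lebesgue_integral_eq_integral(2)[OF ex[OF True]]
      unfolding k[OF True] set_lebesgue_integral_def laplace_def .
    then show ?thesis using True by simp
  next
    case False
    then show ?thesis by (simp add: kernel_def)
  qed
  then show "(\<integral>t. kernel f a b (x, t) \<partial>lborel) = indicator {a..b} x *\<^sub>R laplace (f x) s"
    using m by (simp add: integral_completion)
  show "(\<integral>t. norm (kernel f a b (x, t)) \<partial>lborel) \<le> indicator {a..b} x *\<^sub>R (g x / (Re s - \<sigma>))"
  proof (cases "x \<in> {a..b}")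
    case True
    have e: "((\<lambda>t. exp (- (Re s - \<sigma>) * t)) has_integral 1 / (Re s - \<sigma>)) {0..}"
      using has_integral_exp_minus_to_infinity[of "Re s - \<sigma>" 0] \<sigma> by simp
    have "(\<lambda>t. exp (- (Re s - \<sigma>) * t)) absolutely_integrable_on {0..}"
      using e by (intro nonnegative_absolutely_integrable_1) auto
    then have ei: "integrable lebesgue (\<lambda>t. indicator {0..} t *\<^sub>R exp (- (Re s - \<sigma>) * t))"
      and ev: "(\<integral>t. indicator {0..} t *\<^sub>R exp (- (Re s - \<sigma>) * t) \<partial>lebesgue) = 1 / (Re s - \<sigma>)"
      using set_lebesgue_integral_eq_integral(2)[of "{0..}" "\<lambda>t. exp (- (Re s - \<sigma>) * t)"] e
      unfolding set_integrable_def set_lebesgue_integral_def by (simp_all add: integral_unique)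
    have "(\<integral>t. norm (kernel f a b (x, t)) \<partial>lborel) = (\<integral>t. norm (kernel f a b (x, t)) \<partial>lebesgue)"
      using m by (intro integral_completion[symmetric]) simp
    also have "\<dots> \<le> (\<integral>t. g x * (indicator {0..} t *\<^sub>R exp (- (Re s - \<sigma>) * t)) \<partial>lebesgue)"
    proof (rule integral_mono)
      show "norm (kernel f a b (x, t)) \<le> g x * (indicator {0..} t *\<^sub>R exp (- (Re s - \<sigma>) * t))" for t
        using norm_laplace_integrand[OF f, of x t] True ab unfolding k[OF True]
        by (cases "t \<ge> 0") auto
    qed (use i ei in auto)
    also have "\<dots> = g x / (Re s - \<sigma>)" using ev by simp
    finally show ?thesis using True by simp
  next
    case False
    then show ?thesis by (simp add: kernel_def)
  qed
qed

lemma kernel_integrable: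
  assumes f: "exp_dominated B \<sigma> g f" and ab: "{a..b} \<subseteq> {0..len B}"
  shows "integrable (lborel \<Otimes>\<^sub>M lborel) (kernel f a b)"
proof (rule lborel_pair.Fubini_integrable)
  show km: "kernel f a b \<in> borel_measurable (lborel \<Otimes>\<^sub>M lborel)"
    using kernel_measurable[OF f ab] by (simp add: cong: measurable_cong_sets)
  show "AE x in lborel. integrable lborel (\<lambda>t. kernel f a b (x, t))"
    using kernel_section_t(1)[OF f ab] by simp
  have m: "(\<lambda>x. \<integral>t. norm (kernel f a b (x, t)) \<partial>lborel) \<in> borel_measurable lborel"
    using km by (intro lborel.borel_measurable_lebesgue_integral) (simp add: case_prod_unfold)
  have "g absolutely_integrable_on {a..b}" by (rule absolutely_integrable_on_subinterval[OF g ab])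
  \<comment> \<open>The envelope \<open>g\<close> is known to be measurable only in the Lebesgue
    sense, so the comparison takes place over \<open>lebesgue\<close>; the dominated function is
    Borel, and its integrability returns to \<open>lborel\<close>.\<close>
  then have "integrable lebesgue (\<lambda>x. (indicator {a..b} x *\<^sub>R g x) / (Re s - \<sigma>))"
    unfolding set_integrable_def by (intro integrable_divide)
  then have "integrable lebesgue (\<lambda>x. \<integral>t. norm (kernel f a b (x, t)) \<partial>lborel)"
  proof (rule Bochner_Integration.integrable_bound)
    show "(\<lambda>x. \<integral>t. norm (kernel f a b (x, t)) \<partial>lborel) \<in> borel_measurable lebesgue"
      using m by (rule measurable_completion)
    show "AE x in lebesgue. norm (\<integral>t. norm (kernel f a b (x, t)) \<partial>lborel) \<le> norm (indicator {a..b} x *\<^sub>R g x / (Re s - \<sigma>))"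
    proof (rule AE_I2)
      fix x
      have "norm (\<integral>t. norm (kernel f a b (x, t)) \<partial>lborel) \<le> indicator {a..b} x *\<^sub>R g x / (Re s - \<sigma>)"
        using kernel_section_t(3)[OF f ab, of x] by simp
      also have "\<dots> \<le> norm (indicator {a..b} x *\<^sub>R g x / (Re s - \<sigma>))"
        by (simp only: real_norm_def abs_ge_self)
      finally show "norm (\<integral>t. norm (kernel f a b (x, t)) \<partial>lborel) \<le> norm (indicator {a..b} x *\<^sub>R g x / (Re s - \<sigma>))" .
    qed
  qed
  then show "integrable lborel (\<lambda>x. \<integral>t. norm (kernel f a b (x, t)) \<partial>lborel)"
    using m by (simp add: integrable_completion)
qed

lemma laplace_absolutely_integrable:
  assumes f: "exp_dominated B \<sigma> g f" and ab: "{a..b} \<subseteq> {0..len B}"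
  shows "(\<lambda>x. laplace (f x) s) absolutely_integrable_on {a..b}"
proof -
  have "integrable lborel (\<lambda>x. \<integral>t. kernel f a b (x, t) \<partial>lborel)"
    using lborel_pair.integrable_fst'[OF kernel_integrable[OF f ab]] .
  then have "integrable lborel (\<lambda>x. indicator {a..b} x *\<^sub>R laplace (f x) s)"
    unfolding kernel_section_t(2)[OF f ab] .
  then show ?thesis
    unfolding set_integrable_def by (metis borel_measurable_integrable integrable_completion)
qed

text \<open>Integrating the kernel first over \<open>x\<close> lets the exponential factor out and
  leaves the transform of the spatial integral; integrating first over \<open>t\<close> leaves the
  spatial integral of the transform.\<close>

lemma laplace_integral:
  assumes f: "exp_dominated B \<sigma> g f" and ab: "{a..b} \<subseteq> {0..len B}"
  shows "laplace_exists (\<lambda>t. integral {a..b} (\<lambda>x. f x t)) s"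
    and "laplace (\<lambda>t. integral {a..b} (\<lambda>x. f x t)) s = integral {a..b} (\<lambda>x. laplace (f x) s)"
proof -
  let ?I = "\<lambda>t. \<integral>x. kernel f a b (x, t) \<partial>lborel"
  have I: "?I t = indicator {0..} t *\<^sub>R (of_real (integral {a..b} (\<lambda>x. f x t)) * exp (- s * of_real t))" for t
  proof (cases "t \<ge> 0")
    case True
    have m: "(\<lambda>x. kernel f a b (x, t)) \<in> borel_measurable lborel"
      using measurable_compose[OF measurable_Pair2' kernel_measurable[OF f ab], of t] by simp
    have si: "(\<lambda>x. f x t) absolutely_integrable_on {a..b}"
      by (rule absolutely_integrable_on_subinterval[OF section_absolutely_integrable[OF f True] ab])
    have "?I t = (\<integral>x. kernel f a b (x, t) \<partial>lebesgue)"
      using m by (intro integral_completion[symmetric])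
    also have "\<dots> = (\<integral>x. complex_of_real (indicator {a..b} x *\<^sub>R f x t) * exp (- s * of_real t) \<partial>lebesgue)"
      using True by (intro Bochner_Integration.integral_cong) (auto simp: kernel_def indicator_def)
    also have "\<dots> = (\<integral>x. complex_of_real (indicator {a..b} x *\<^sub>R f x t) \<partial>lebesgue) * exp (- s * of_real t)"
      using si unfolding set_integrable_def by simp
    also have "(\<integral>x. complex_of_real (indicator {a..b} x *\<^sub>R f x t) \<partial>lebesgue) = of_real (\<integral>x. indicator {a..b} x *\<^sub>R f x t \<partial>lebesgue)"
      using si unfolding set_integrable_def by (rule integral_of_real)
    also have "(\<integral>x. indicator {a..b} x *\<^sub>R f x t \<partial>lebesgue) = integral {a..b} (\<lambda>x. f x t)"
      using set_lebesgue_integral_eq_integral(2)[OF si] unfolding set_lebesgue_integral_def .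
    finally show ?thesis using True by simp
  next
    case False
    then show ?thesis by (simp add: kernel_def)
  qed
  have km: "integrable (lborel \<Otimes>\<^sub>M lborel) (case_prod (\<lambda>x t. kernel f a b (x, t)))"
    using kernel_integrable[OF f ab] by simp
  have Ii: "integrable lborel ?I" by (rule lborel_pair.integrable_snd[OF km])
  then show ex: "laplace_exists (\<lambda>t. integral {a..b} (\<lambda>x. f x t)) s"
    unfolding I laplace_exists_def set_integrable_def
    by (metis (no_types, lifting) borel_measurable_integrable integrable_completion)
  have "laplace (\<lambda>t. integral {a..b} (\<lambda>x. f x t)) s = (\<integral>t. ?I t \<partial>lebesgue)"
    using set_lebesgue_integral_eq_integral(2)[OF ex[unfolded laplace_exists_def]]
    unfolding I laplace_def set_lebesgue_integral_def by simp
  also have "\<dots> = (\<integral>t. ?I t \<partial>lborel)" using Ii by (intro integral_completion) auto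
  also have "\<dots> = (\<integral>x. (\<integral>t. kernel f a b (x, t) \<partial>lborel) \<partial>lborel)"
    by (rule lborel_pair.Fubini_integral[OF km])
  also have "\<dots> = (\<integral>x. indicator {a..b} x *\<^sub>R laplace (f x) s \<partial>lborel)"
    unfolding kernel_section_t(2)[OF f ab] ..
  also have "\<dots> = (\<integral>x. indicator {a..b} x *\<^sub>R laplace (f x) s \<partial>lebesgue)"
  proof (rule integral_completion[symmetric])
    have "integrable lborel (\<lambda>x. \<integral>t. kernel f a b (x, t) \<partial>lborel)"
      using lborel_pair.integrable_fst'[OF kernel_integrable[OF f ab]] .
    then show "(\<lambda>x. indicator {a..b} x *\<^sub>R laplace (f x) s) \<in> borel_measurable lborel"
      unfolding kernel_section_t(2)[OF f ab] by auto
  qed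
  also have "\<dots> = integral {a..b} (\<lambda>x. laplace (f x) s)"
    using set_lebesgue_integral_eq_integral(2)[OF laplace_absolutely_integrable[OF f ab]]
    unfolding set_lebesgue_integral_def .
  finally show "laplace (\<lambda>t. integral {a..b} (\<lambda>x. f x t)) s = integral {a..b} (\<lambda>x. laplace (f x) s)" .
qed

end

section \<open>One-sided limits and regularity on the halves of the beam\<close>

lemma has_ac_derivative_linear_combination:
  fixes f f' g g' :: "real \<Rightarrow> complex"
  assumes "has_ac_derivative f g S" "has_ac_derivative f' g' S"
    and S: "\<And>x y. x \<in> S \<Longrightarrow> y \<in> S \<Longrightarrow> {x..y} \<subseteq> S"
  shows "has_ac_derivative (\<lambda>x. c * f x + d * f' x) (\<lambda>x. c * g x + d * g' x) S"
  unfolding has_ac_derivative_def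
proof (intro conjI ballI impI)
  note i = assms(1,2)[THEN has_ac_derivative_absolutely_integrable]
  have "(\<lambda>x. c * g x) absolutely_integrable_on S" "(\<lambda>x. d * g' x) absolutely_integrable_on S"
    using absolutely_integrable_linear[OF i(1) bounded_linear_mult_right[of c]]
      absolutely_integrable_linear[OF i(2) bounded_linear_mult_right[of d]] by (simp_all add: comp_def)
  then show "(\<lambda>x. c * g x + d * g' x) absolutely_integrable_on S" by (rule set_integral_add(1))
  fix x y assume xy: "x \<in> S" "y \<in> S" "x \<le> y"
  have "((\<lambda>x. c * g x + d * g' x) has_integral c * integral {x..y} g + d * integral {x..y} g') {x..y}"
    using i[THEN absolutely_integrable_imp_integrable_subinterval, OF S[OF xy(1,2)]]
    by (intro has_integral_add has_integral_mult_right integrable_integral)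
  then show "c * f y + d * f' y - (c * f x + d * f' x) = integral {x..y} (\<lambda>x. c * g x + d * g' x)"
    unfolding integral_unique[OF \<open>(_ has_integral _) {x..y}\<close>] assms(1,2)[THEN has_ac_derivative_diff_eq, OF xy, symmetric]
    by (simp add: algebra_simps)
qed

text \<open>The missing end point is a null set, so \<open>g\<close> is integrable up to it. Writing
  the limit as an end value plus an integral is what later allows it to be Laplace
  transformed.\<close>

lemma has_ac_derivative_left_limit:
  fixes f :: "real \<Rightarrow> 'a::euclidean_space"
  assumes "has_ac_derivative f g {a..<b}" "a < b"
  shows "(f \<longlongrightarrow> f a + integral {a..b} g) (at_left b)"
proof (rule tendsto_at_left_of_eq)
  have "g absolutely_integrable_on {a..b}"
    using has_ac_derivative_absolutely_integrable[OF assms(1)]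
    by (rule absolutely_integrable_spike_set) (auto intro: negligible_subset[of "{b}"])
  then show "continuous_on {a..b} (\<lambda>x. f a + integral {a..x} g)"
    by (intro continuous_intros has_ac_derivative_continuous[OF has_ac_derivative_integral])
  show "f y = f a + integral {a..y} g" if "y \<in> {a..<b}" for y
    using has_ac_derivative_diff_eq[OF assms(1), of a y] that by (simp add: algebra_simps)
qed (use assms(2) in auto)

lemma has_ac_derivative_right_limit:
  fixes f :: "real \<Rightarrow> 'a::euclidean_space"
  assumes "has_ac_derivative f g {a<..b}" "a < b"
  shows "(f \<longlongrightarrow> f b - integral {a..b} g) (at_right a)"
proof (rule tendsto_at_right_of_eq)
  have "g absolutely_integrable_on {a..b}"
    using has_ac_derivative_absolutely_integrable[OF assms(1)]
    by (rule absolutely_integrable_spike_set) (auto intro: negligible_subset[of "{a}"])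
  then have "g integrable_on {a..b}"
    by (rule set_lebesgue_integral_eq_integral(1))
  then show "continuous_on {a..b} (\<lambda>x. f b - integral {x..b} g)"
    by (intro continuous_intros indefinite_integral_continuous_1')
  show "f y = f b - integral {y..b} g" if "y \<in> {a<..b}" for y
    using has_ac_derivative_diff_eq[OF assms(1), of y b] that by (simp add: algebra_simps)
qed (use assms(2) in auto)

lemma half_beam_interval:
  "S \<in> {{0..<pos B}, {pos B<..len B}} \<Longrightarrow> x \<in> S \<Longrightarrow> y \<in> S \<Longrightarrow> {x..y} \<subseteq> S"
  by auto

lemma half_beam_subset:
  "valid_beam B \<Longrightarrow> S \<in> {{0..<pos B}, {pos B<..len B}} \<Longrightarrow> S \<subseteq> {0..len B}"
  by (auto simp: valid_beam_def)

text \<open>The passage from absolute continuity to derivatives is stated for closed intervals,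
  while the halves lack the end point \<open>pos B\<close>. Cutting at the midpoint between
  \<open>x\<close> and \<open>pos B\<close> gives a closed interval with the same neighbourhoods of
  \<open>x\<close>.\<close>

lemma half_beam_closed_neighbourhood:
  assumes "valid_beam B" "S \<in> {{0..<pos B}, {pos B<..len B}}" "x \<in> S"
  obtains u v where "u < v" "x \<in> {u..v}" "{u..v} \<subseteq> S" "at x within S = at x within {u..v}"
proof (cases "S = {0..<pos B}")
  case True
  then have x: "0 \<le> x" "x < pos B" using assms(3) by auto
  let ?v = "(x + pos B) / 2"
  have "at x within S = at x within {0..?v}"
    by (rule at_within_nhd[of _ "{..<?v}"]) (use x True in auto)
  then show ?thesis by (intro that[of 0 ?v]) (use x True in auto)
next
  case False
  then have S: "S = {pos B<..len B}" using assms(2) by auto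
  then have x: "pos B < x" "x \<le> len B" using assms(3) by auto
  let ?u = "(x + pos B) / 2"
  have "at x within S = at x within {?u..len B}"
    by (rule at_within_nhd[of _ "{?u<..}"]) (use x S in auto)
  then show ?thesis by (intro that[of ?u "len B"]) (use x S in auto)
qed

text \<open>Orders below three have no jump, so the relation may cross the attachment point. For
  \<open>i = 2\<close> the derivative may fail to exist at \<open>pos B\<close>, but
  \<open>W 2\<close> is continuous there and the fundamental theorem tolerates one exceptional
  point.\<close>

lemma beam_profile_diff_eq_integral:
  fixes W :: "nat \<Rightarrow> real \<Rightarrow> 'a::euclidean_space"
  assumes "valid_beam B" "beam_profile B W" "i < 3" "x \<in> {0..len B}" "y \<in> {0..len B}" "x \<le> y"
  shows "W i y - W i x = integral {x..y} (W (Suc i))"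
proof -
  note p = assms(2)[unfolded beam_profile_def]
  have pl: "0 < pos B" "pos B < len B" using assms(1) by (auto simp: valid_beam_def)
  have d0: "\<And>x. x \<in> {0..len B} \<Longrightarrow> (W 0 has_vector_derivative W 1 x) (at x within {0..len B})"
    and d1: "\<And>x. x \<in> {0..len B} \<Longrightarrow> (W 1 has_vector_derivative W 2 x) (at x within {0..len B})"
    and c2: "continuous_on {0..len B} (W 2)"
    and d2: "\<And>S x. S \<in> {{0..<pos B}, {pos B<..len B}} \<Longrightarrow> x \<in> S \<Longrightarrow> (W 2 has_vector_derivative W 3 x) (at x within S)"
    using p by blast+
  have "(W 3 has_integral W 2 y - W 2 x) {x..y}"
  proof (rule fundamental_theorem_of_calculus_interior_strong[where S="{pos B}" and f="W 2"])
    show "(W 2 has_vector_derivative W 3 z) (at z)" if z: "z \<in> {x<..<y} - {pos B}" for z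
    proof (cases "z < pos B")
      case True
      have "at z within {0..<pos B} = at z"
        by (rule at_within_interior) (use z True assms(4) in auto)
      then show ?thesis using d2[of "{0..<pos B}" z] z True assms(4) by auto
    next
      case False
      have "at z within {pos B<..len B} = at z"
        by (rule at_within_interior) (use z False assms(5) in auto)
      then show ?thesis using d2[of "{pos B<..len B}" z] z False assms(5) by auto
    qed
    show "continuous_on {x..y} (W 2)"
      by (rule continuous_on_subset[OF c2]) (use assms(4,5) in auto)
  qed (use assms in auto)
  then have 2: "W 2 y - W 2 x = integral {x..y} (W 3)" by (simp add: integral_unique)
  have 0: "has_ac_derivative (W 0) (W 1) {0..len B}"
    by (rule has_ac_derivative_of_vector_derivative[OF d0 continuous_on_vector_derivative[OF d1]])
  have 1: "has_ac_derivative (W 1) (W 2) {0..len B}"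
    by (rule has_ac_derivative_of_vector_derivative[OF d1 c2])
  consider "i = 0" | "i = 1" | "i = 2" using assms(3) by linarith
  then show ?thesis
    using 2 has_ac_derivative_diff_eq[OF 0 assms(4-6)] has_ac_derivative_diff_eq[OF 1 assms(4-6)]
    by cases (simp_all add: numeral_eq_Suc)
qed

section \<open>Laplace transforms of beam profiles\<close>

context laplace_dominated
begin

text \<open>The transform is applied to the increment equation at fixed \<open>x\<close> and
  \<open>y\<close>, and \<open>laplace_integral\<close> moves it under the spatial integral.\<close>

lemma laplace_has_ac_derivative:
  assumes f: "exp_dominated B \<sigma> g f" and f': "exp_dominated B \<sigma> g f'"
    and S: "S \<subseteq> {0..len B}" "S \<in> sets lebesgue"
    and diff: "\<And>t x y. t \<ge> 0 \<Longrightarrow> x \<in> S \<Longrightarrow> y \<in> S \<Longrightarrow> x \<le> y \<Longrightarrow> f y t - f x t = integral {x..y} (\<lambda>z. f' z t)"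
  shows "has_ac_derivative (\<lambda>x. laplace (f x) s) (\<lambda>x. laplace (f' x) s) S"
  unfolding has_ac_derivative_def
proof (intro conjI ballI impI)
  show "(\<lambda>x. laplace (f' x) s) absolutely_integrable_on S"
    using laplace_absolutely_integrable[OF f' subset_refl] S(2,1) by (rule set_integrable_subset)
  fix x y assume xy: "x \<in> S" "y \<in> S" "x \<le> y"
  then have sub: "x \<in> {0..len B}" "y \<in> {0..len B}" "{x..y} \<subseteq> {0..len B}" using S(1) by auto
  have "laplace (f y) s - laplace (f x) s = laplace (\<lambda>t. f y t - f x t) s"
    by (rule laplace_diff(2)[symmetric]) (intro laplace_exists_dominated f sub)+
  also have "\<dots> = laplace (\<lambda>t. integral {x..y} (\<lambda>z. f' z t)) s"
    using diff xy by (intro laplace_cong) blast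
  also have "\<dots> = integral {x..y} (\<lambda>z. laplace (f' z) s)"
    by (rule laplace_integral(2)[OF f' sub(3)])
  finally show "laplace (f y) s - laplace (f x) s = integral {x..y} (\<lambda>z. laplace (f' z) s)" .
qed

text \<open>The integral relations are transformed as they stand; classical derivatives then follow
  from continuity of the next transform. For order two this continuity holds only on each half,
  hence the localisation to a closed interval.\<close>

lemma beam_profile_laplace:
  assumes valid: "valid_beam B"
    and D: "\<And>t. t \<ge> 0 \<Longrightarrow> beam_profile B (\<lambda>n x. D n x t)"
    and dom: "\<And>n. n \<le> 4 \<Longrightarrow> exp_dominated B \<sigma> g (D n)"
  shows "beam_profile B (\<lambda>n x. laplace (D n x) s)"
proof -
  define W where "W = (\<lambda>n x. laplace (D n x) s)"
  have ac: "has_ac_derivative (W i) (W (Suc i)) {0..len B}" if "i < 3" for i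
    unfolding W_def
    by (rule laplace_has_ac_derivative)
      (use that dom beam_profile_diff_eq_integral[OF valid D] in auto)
  have ac3: "has_ac_derivative (W 3) (W 4) S" if S: "S \<in> {{0..<pos B}, {pos B<..len B}}" for S
    unfolding W_def
  proof (rule laplace_has_ac_derivative)
    show "S \<subseteq> {0..len B}" using half_beam_subset[OF valid S] .
    show "S \<in> sets lebesgue" using S by auto
    show "D 3 y t - D 3 x t = integral {x..y} (\<lambda>z. D 4 z t)" if "t \<ge> 0" "x \<in> S" "y \<in> S" "x \<le> y" for t x y
      using D[OF that(1)] S that(2-) unfolding beam_profile_def has_ac_derivative_def by blast
  qed (use dom in auto)
  have cont: "continuous_on {0..len B} (W i)" if "i < 3" for i
    by (rule has_ac_derivative_continuous[OF ac[OF that]])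
  have d: "(W i has_vector_derivative W (Suc i) x) (at x within {0..len B})" if "i < 2" "x \<in> {0..len B}" for i x
    using that by (intro has_vector_derivative_of_ac_derivative ac cont) auto
  have d2: "(W 2 has_vector_derivative W 3 x) (at x within S)"
    if S: "S \<in> {{0..<pos B}, {pos B<..len B}}" and x: "x \<in> S" for S x
  proof -
    obtain u v where uv: "u < v" "x \<in> {u..v}" "{u..v} \<subseteq> S" "at x within S = at x within {u..v}"
      by (rule half_beam_closed_neighbourhood[OF valid S x])
    have "has_ac_derivative (W 2) (W 3) {u..v}"
      using has_ac_derivative_subset[OF ac[of 2] subset_trans[OF uv(3) half_beam_subset[OF valid S]]]
      by (simp add: numeral_eq_Suc)
    then show ?thesis
      unfolding uv(4)
      by (rule has_vector_derivative_of_ac_derivative[OF _ has_ac_derivative_continuous uv(2)])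
        (rule has_ac_derivative_subset[OF ac3[OF S] uv(3)])
  qed
  have "beam_profile B W"
    unfolding beam_profile_def
    using d[of 0] d[of 1] cont[of 2] d2 ac3 by (simp add: numeral_2_eq_2)
  then show ?thesis by (simp add: W_def)
qed

end

text \<open>Uniqueness of derivatives lifts the proportionality from order 0 to order 3. At order 4
  the derivative is fixed only up to a null set, and the argument stops.\<close>

lemma beam_profile_scaled:
  fixes W V :: "nat \<Rightarrow> real \<Rightarrow> complex"
  assumes valid: "valid_beam B" and W: "beam_profile B W" and V: "beam_profile B V"
    and 0: "\<And>x. x \<in> {0..len B} \<Longrightarrow> V 0 x = s * W 0 x"
    and S: "S \<in> {{0..<pos B}, {pos B<..len B}}" and x: "x \<in> S"
  shows "V 3 x = s * W 3 x"
proof -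
  note p = W[unfolded beam_profile_def] and q = V[unfolded beam_profile_def]
  have len: "0 < len B" using valid by (auto simp: valid_beam_def)
  have step: "V' x = s * W' x"
    if "\<And>y. y \<in> {u..v} \<Longrightarrow> V'' y = s * W'' y" "u < v" "x \<in> {u..v}"
      "(V'' has_vector_derivative V' x) (at x within {u..v})"
      "(W'' has_vector_derivative W' x) (at x within {u..v})" for u v x and V'' W'' V' W' :: "real \<Rightarrow> complex"
  proof -
    have "((\<lambda>y. s * W'' y) has_vector_derivative s * W' x) (at x within {u..v})"
      by (rule has_vector_derivative_mult_right[OF that(5)])
    from has_vector_derivative_transform[OF that(3) _ this]
    have "(V'' has_vector_derivative s * W' x) (at x within {u..v})"
      using that(1) by blast
    with that(4) show ?thesis
      using vector_derivative_unique_within_closed_interval[of u v x] that(2,3) by simp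
  qed
  have 1: "V 1 x = s * W 1 x" if "x \<in> {0..len B}" for x
    by (rule step[of 0 "len B" "V 0" "W 0"]) (use 0 len that p q in auto)
  have 2: "V 2 x = s * W 2 x" if "x \<in> {0..len B}" for x
    by (rule step[of 0 "len B" "V 1" "W 1"]) (use 1 len that p q in auto)
  obtain u v where uv: "u < v" "x \<in> {u..v}" "{u..v} \<subseteq> S" "at x within S = at x within {u..v}"
    by (rule half_beam_closed_neighbourhood[OF valid S x])
  have "(V 2 has_vector_derivative V 3 x) (at x within {u..v})"
    "(W 2 has_vector_derivative W 3 x) (at x within {u..v})"
    using p q S x unfolding uv(4)[symmetric] by blast+
  moreover have "V 2 y = s * W 2 y" if "y \<in> {u..v}" for y
    using 2 half_beam_subset[OF valid S] uv(3) that by blast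
  ultimately show ?thesis
    by (intro step[OF _ uv(1,2)])
qed

section \<open>From trajectories to the boundary value problem\<close>

lemma control_system_imp_transformed_system:
  assumes valid: "valid_beam B" and EId: "EI_damped B s \<noteq> 0"
    and sys: "control_system B k \<psi>2 p loc u y D V A" and adm: "laplace_admissible B k s u D V A"
  obtains W where "transformed_system B k \<psi>2 s (\<lambda>j. laplace (u j) s) W"
    and "\<And>x. x \<in> {0..len B} \<Longrightarrow> laplace_exists (D 2 x) s \<and> W 2 x = laplace (D 2 x) s"
proof -
  note c = sys[unfolded control_system_def]
  obtain \<sigma> g where \<sigma>: "\<sigma> < Re s" and g: "g absolutely_integrable_on {0..len B}"
    and domA: "exp_dominated B \<sigma> g A"
    and domD: "\<And>n. n \<le> 4 \<Longrightarrow> exp_dominated B \<sigma> g (D n)"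
    and domV: "\<And>n. n \<le> 4 \<Longrightarrow> exp_dominated B \<sigma> g (V n)"
    and u: "\<And>j. j \<le> k \<Longrightarrow> laplace_exists (u j) s"
    using adm unfolding laplace_admissible_def by blast
  interpret laplace_dominated B \<sigma> g s by unfold_locales (fact \<sigma> g)+
  have pl: "0 < pos B" "pos B < len B" and rho: "rho B \<noteq> 0"
    using valid by (auto simp: valid_beam_def)
  have exA: "laplace_exists (A x) s" and exD: "n \<le> 4 \<Longrightarrow> laplace_exists (D n x) s"
    and exV: "n \<le> 4 \<Longrightarrow> laplace_exists (V n x) s" if "x \<in> {0..len B}" for x n
    using laplace_exists_dominated[OF _ that] domA domD domV by blast+
  define WD WV where "WD = (\<lambda>n x. laplace (D n x) s)" and "WV = (\<lambda>n x. laplace (V n x) s)"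
  have D: "beam_profile B (\<lambda>n x. D n x t)" and V: "beam_profile B (\<lambda>n x. V n x t)" if "t \<ge> 0" for t
    using c that by blast+
  have PD: "beam_profile B WD" unfolding WD_def by (rule beam_profile_laplace[OF valid D domD])
  have PV: "beam_profile B WV" unfolding WV_def by (rule beam_profile_laplace[OF valid V domV])
  have V0: "WV 0 x = s * WD 0 x" if x: "x \<in> {0..len B}" for x
    unfolding WV_def WD_def
  proof (rule laplace_derivative[OF _ _ \<sigma>])
    show "(D 0 x has_vector_derivative V 0 x t) (at t within {0..})" if "t \<ge> 0" for t
      using c x that by blast
    show "\<bar>D 0 x t\<bar> \<le> g x * exp (\<sigma> * t)" if "t \<ge> 0" for t
      using domD[of 0] x that unfolding exp_dominated_def by simp
    show "D 0 x 0 = 0" using c x by blast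
  qed (use exD[OF x] exV[OF x] in auto)
  have A0: "laplace (A x) s = s\<^sup>2 * WD 0 x" if x: "x \<in> {0..len B}" for x
  proof -
    have "laplace (A x) s = s * WV 0 x"
      unfolding WV_def
    proof (rule laplace_derivative[OF _ _ \<sigma>])
      show "(V 0 x has_vector_derivative A x t) (at t within {0..})" if "t \<ge> 0" for t
        using c x that by blast
      show "\<bar>V 0 x t\<bar> \<le> g x * exp (\<sigma> * t)" if "t \<ge> 0" for t
        using domV[of 0] x that unfolding exp_dominated_def by simp
      show "V 0 x 0 = 0" using c x by blast
    qed (use exA[OF x] exV[OF x] in auto)
    then show ?thesis using V0[OF x] by (simp add: power2_eq_square)
  qed
  define E where "E = EI_damped B s"
  have E: "E = of_real (EI B) + of_real (rho B) * of_real (damp B) * s" "E \<noteq> 0"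
    using EId by (simp_all add: E_def EI_damped_def)
  \<comment> \<open>The transformed equation contains \<open>EI B\<close> times \<open>WD 4\<close>
    plus \<open>rho B * damp B\<close> times \<open>WV 4\<close>; \<open>a\<close> and
    \<open>b\<close> are these weights divided by \<open>E\<close>. Because
    \<open>WV 3 = s * WD 3\<close> on the halves and \<open>a + b * s = 1\<close>, the same
    combination at order three is just \<open>WD 3\<close>.\<close>
  define a b where "a = complex_of_real (EI B) / E" and "b = complex_of_real (rho B) * of_real (damp B) / E"
  have "a + b * s = E / E"
    unfolding a_def b_def by (simp add: E(1) flip: add_divide_distrib)
  then have ab: "a + b * s = 1" "E * a = of_real (EI B)" "E * b = of_real (rho B) * of_real (damp B)"
    using E(2) by (simp_all add: a_def b_def)
  text \<open>The transform of \<open>D 4\<close> agrees with this choice of fourth derivative only almost everywhere;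
    the choice makes the transformed equation immediate.\<close>
  define W where "W = WD(4 := (\<lambda>x. a * WD 4 x + b * WV 4 x))"
  have Wn: "W 0 = WD 0" "W 1 = WD 1" "W 2 = WD 2" "W 3 = WD 3"
    and W4: "W 4 = (\<lambda>x. a * WD 4 x + b * WV 4 x)"
    by (simp_all add: W_def)
  have "has_ac_derivative (WD 3) (W 4) S" if S: "S \<in> {{0..<pos B}, {pos B<..len B}}" for S
  proof (rule has_ac_derivative_cong)
    have "has_ac_derivative (WD 3) (WD 4) S" "has_ac_derivative (WV 3) (WV 4) S"
      using PD PV S unfolding beam_profile_def by blast+
    then show "has_ac_derivative (\<lambda>x. a * WD 3 x + b * WV 3 x) (\<lambda>x. a * WD 4 x + b * WV 4 x) S"
      using half_beam_interval[OF S] by (rule has_ac_derivative_linear_combination)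
    show "a * WD 3 x + b * WV 3 x = WD 3 x" if "x \<in> S" for x
    proof -
      have "a * WD 3 x + b * WV 3 x = (a + b * s) * WD 3 x"
        using beam_profile_scaled[OF valid PD PV V0 S that] by (simp add: algebra_simps)
      then show ?thesis by (simp add: ab)
    qed
    show "{x..y} \<subseteq> S" if "x \<in> S" "y \<in> S" for x y
      using half_beam_interval[OF S that] .
  qed (simp add: W4)
  then have PW: "beam_profile B W"
    using PD[unfolded beam_profile_def] unfolding beam_profile_def Wn by (intro conjI ballI) blast+
  have zero: "laplace f s = 0" if "\<And>t. t \<ge> 0 \<Longrightarrow> f t = 0" for f
    using laplace_cong[of f "\<lambda>_. 0" s] that laplace_zero(2) by simp
  have bc: "W 0 0 = 0" "W 0 (len B) = 0" "W 2 0 = 0" "W 2 (len B) = 0"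
    unfolding Wn WD_def by (rule zero; use c in blast)+
  have pde: "AE x in lebesgue. x \<in> {0..<pos B} \<union> {pos B<..len B} \<longrightarrow>
        EI_damped B s * W 4 x + of_real (rho B) * s\<^sup>2 * W 0 x = (\<Sum>j=1..k. of_real (\<psi>2 j x) * laplace (u j) s)"
  proof -
    \<comment> \<open>The exceptional null set does not depend on \<open>t\<close>: at every other
      \<open>x\<close> the equation holds along the whole time axis and can be transformed term by
      term.\<close>
    have "AE x in lebesgue. x \<in> {0..<pos B} \<union> {pos B<..len B} \<longrightarrow> (\<forall>t\<ge>0.
        A x t + EI B / rho B * D 4 x t + damp B * V 4 x t = 1 / rho B * (\<Sum>j=1..k. \<psi>2 j x * u j t))"
      using c by blast
    then show ?thesis
    proof (eventually_elim, intro impI)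
      fix x assume eq: "x \<in> {0..<pos B} \<union> {pos B<..len B} \<longrightarrow> (\<forall>t\<ge>0.
        A x t + EI B / rho B * D 4 x t + damp B * V 4 x t = 1 / rho B * (\<Sum>j=1..k. \<psi>2 j x * u j t))"
        and xS: "x \<in> {0..<pos B} \<union> {pos B<..len B}"
      then have x: "x \<in> {0..len B}" using pl by auto
      have ex4: "laplace_exists (D 4 x) s" "laplace_exists (V 4 x) s"
        using exD[OF x, of 4] exV[OF x, of 4] by simp_all
      have exs: "\<And>j. j \<in> {1..k} \<Longrightarrow> laplace_exists (\<lambda>t. \<psi>2 j x * u j t) s"
        using laplace_cmult(1) u by auto
      have "laplace (\<lambda>t. A x t + EI B / rho B * D 4 x t + damp B * V 4 x t) s
        = laplace (A x) s + of_real (EI B / rho B) * WD 4 x + of_real (damp B) * WV 4 x"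
        unfolding WD_def WV_def
        using exA[OF x] laplace_cmult[OF ex4(1), of "EI B / rho B"] laplace_cmult[OF ex4(2), of "damp B"]
        by (simp only: laplace_add)
      moreover have "laplace (\<lambda>t. 1 / rho B * (\<Sum>j=1..k. \<psi>2 j x * u j t)) s
        = of_real (1 / rho B) * (\<Sum>j=1..k. of_real (\<psi>2 j x) * laplace (u j) s)"
      proof -
        have "(\<Sum>j=1..k. laplace (\<lambda>t. \<psi>2 j x * u j t) s) = (\<Sum>j=1..k. of_real (\<psi>2 j x) * laplace (u j) s)"
          using u by (intro sum.cong refl laplace_cmult(2)) auto
        then show ?thesis
          using laplace_sum[where J="{1..k}" and f="\<lambda>j t. \<psi>2 j x * u j t" and s=s, OF exs]
          by (simp only: laplace_cmult(2))
      qed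
      moreover have "laplace (\<lambda>t. A x t + EI B / rho B * D 4 x t + damp B * V 4 x t) s
        = laplace (\<lambda>t. 1 / rho B * (\<Sum>j=1..k. \<psi>2 j x * u j t)) s"
        using eq xS by (intro laplace_cong) blast
      ultimately have "s\<^sup>2 * WD 0 x + of_real (EI B / rho B) * WD 4 x + of_real (damp B) * WV 4 x
        = of_real (1 / rho B) * (\<Sum>j=1..k. of_real (\<psi>2 j x) * laplace (u j) s)"
        using A0[OF x] by simp
      then have *: "of_real (rho B) * s\<^sup>2 * WD 0 x + of_real (EI B) * WD 4 x + of_real (rho B) * of_real (damp B) * WV 4 x
        = (\<Sum>j=1..k. of_real (\<psi>2 j x) * laplace (u j) s)"
        using rho by (simp add: field_simps)
      have "EI_damped B s * W 4 x = (E * a) * WD 4 x + (E * b) * WV 4 x"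
        by (simp add: W4 E_def algebra_simps)
      then show "EI_damped B s * W 4 x + of_real (rho B) * s\<^sup>2 * W 0 x = (\<Sum>j=1..k. of_real (\<psi>2 j x) * laplace (u j) s)"
        using * unfolding Wn ab by (simp add: algebra_simps)
    qed
  qed
  have interface: "(of_real (mass B) * s\<^sup>2 + of_real (kappa B)) * W 0 (pos B)
       = of_real (EI B) * Lim (at_left (pos B)) (W 3) - of_real (EI B) * Lim (at_right (pos B)) (W 3) + laplace (u 0) s"
  proof -
    \<comment> \<open>The spatial limit is never interchanged with the transform directly: each
      one-sided limit is an end value plus or minus an integral of \<open>D 4\<close>, and both of
      these have known transforms.\<close>
    let ?l = "\<lambda>t. D 3 0 t + integral {0..pos B} (\<lambda>x. D 4 x t)"
    let ?r = "\<lambda>t. D 3 (len B) t - integral {pos B..len B} (\<lambda>x. D 4 x t)"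
    have l: "Lim (at_left (pos B)) (\<lambda>x. D 3 x t) = ?l t"
      and r: "Lim (at_right (pos B)) (\<lambda>x. D 3 x t) = ?r t" if "t \<ge> 0" for t
      using D[OF that] pl unfolding beam_profile_def
      by (auto intro!: tendsto_Lim has_ac_derivative_left_limit has_ac_derivative_right_limit)
    have Wl: "Lim (at_left (pos B)) (W 3) = WD 3 0 + integral {0..pos B} (WD 4)"
      and Wr: "Lim (at_right (pos B)) (W 3) = WD 3 (len B) - integral {pos B..len B} (WD 4)"
      using PD pl unfolding beam_profile_def Wn
      by (auto intro!: tendsto_Lim has_ac_derivative_left_limit has_ac_derivative_right_limit)
    have dom4: "exp_dominated B \<sigma> g (D 4)" using domD[of 4] by simp
    have sub: "{0..pos B} \<subseteq> {0..len B}" "{pos B..len B} \<subseteq> {0..len B}" using pl by auto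
    have ex3: "laplace_exists (D 3 0) s" "laplace_exists (D 3 (len B)) s" "laplace_exists (D 0 (pos B)) s"
      "laplace_exists (A (pos B)) s"
      using exD[of 0 3] exD[of "len B" 3] exD[of "pos B" 0] exA[of "pos B"] pl by simp_all
    have exl: "laplace_exists ?l s" and ll: "laplace ?l s = Lim (at_left (pos B)) (W 3)"
      using laplace_add[OF ex3(1) laplace_integral(1)[OF dom4 sub(1)]] laplace_integral(2)[OF dom4 sub(1)]
      unfolding Wl by (simp_all add: WD_def)
    have exr: "laplace_exists ?r s" and lr: "laplace ?r s = Lim (at_right (pos B)) (W 3)"
      using laplace_diff[OF ex3(2) laplace_integral(1)[OF dom4 sub(2)]] laplace_integral(2)[OF dom4 sub(2)]
      unfolding Wr by (simp_all add: WD_def)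
    have "laplace (\<lambda>t. mass B * A (pos B) t + kappa B * D 0 (pos B) t) s
      = of_real (mass B) * laplace (A (pos B)) s + of_real (kappa B) * WD 0 (pos B)"
      unfolding WD_def using laplace_cmult[OF ex3(4), of "mass B"] laplace_cmult[OF ex3(3), of "kappa B"]
      by (simp only: laplace_add)
    moreover have "laplace (\<lambda>t. EI B * ?l t - EI B * ?r t + u 0 t) s
      = of_real (EI B) * laplace ?l s - of_real (EI B) * laplace ?r s + laplace (u 0) s"
      using laplace_cmult[OF exl, of "EI B"] laplace_cmult[OF exr, of "EI B"] u[of 0]
      by (simp only: laplace_add laplace_diff le0)
    moreover have "laplace (\<lambda>t. mass B * A (pos B) t + kappa B * D 0 (pos B) t) s
      = laplace (\<lambda>t. EI B * ?l t - EI B * ?r t + u 0 t) s"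
    proof (rule laplace_cong)
      fix t :: real assume t: "t \<ge> 0"
      have "mass B * A (pos B) t + kappa B * D 0 (pos B) t
        = EI B * Lim (at_left (pos B)) (\<lambda>x. D 3 x t) - EI B * Lim (at_right (pos B)) (\<lambda>x. D 3 x t) + u 0 t"
        using c t by blast
      then show "mass B * A (pos B) t + kappa B * D 0 (pos B) t = EI B * ?l t - EI B * ?r t + u 0 t"
        unfolding l[OF t] r[OF t] .
    qed
    moreover have "laplace (A (pos B)) s = s\<^sup>2 * WD 0 (pos B)"
      using pl by (intro A0) simp
    ultimately show ?thesis unfolding Wn(1) ll lr by (simp add: algebra_simps)
  qed
  have "transformed_system B k \<psi>2 s (\<lambda>j. laplace (u j) s) W"
    unfolding transformed_system_def using PW pde bc interface by blast
  moreover have "laplace_exists (D 2 x) s \<and> W 2 x = laplace (D 2 x) s" if "x \<in> {0..len B}" for x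
    using exD[OF that, of 2] by (simp add: Wn WD_def)
  ultimately show thesis by (rule that)
qed

section \<open>Transfer matrix of the controlled beam\<close>

theorem lemma1:
  fixes B :: beam and k p :: nat and \<psi> \<psi>2 :: "nat \<Rightarrow> real \<Rightarrow> real"
    and loc :: "nat \<Rightarrow> real" and s \<alpha> \<gamma> :: complex
  assumes "valid_beam B"
    and "\<forall>j\<in>{1..k}. integrable_second_derivative (len B) (\<psi> j) (\<psi>2 j)"
    and "\<forall>i\<in>{1..p}. loc i \<in> {0..len B}"
    and "s \<noteq> 0"
    and "EI_damped B s \<noteq> 0"
    and "\<alpha> ^ 4 = of_real (rho B) / EI_damped B s"
    and "\<gamma> = \<alpha> * csqrt (2 * s) / 2"
    and "invertible (M_matrix B s \<gamma>)"
  defines "H \<equiv> (\<lambda>i j. h_fun B \<psi>2 s \<gamma> j (loc i))"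
  shows "transfer_matrix B k \<psi>2 p loc s H \<and>
    (\<forall>u y D V A. control_system B k \<psi>2 p loc u y D V A \<and> laplace_admissible B k s u D V A \<longrightarrow>
       (\<forall>i\<in>{1..p}. laplace_exists (y i) s \<and>
          laplace (y i) s = (\<Sum>j=0..k. H i j * laplace (u j) s)))"
proof -
  \<comment> \<open>Only the fourth power of the root enters: it is \<open>4 * s\<^sup>2\<close> for
    either branch, and the 16 from halving leaves
    \<open>4 * \<gamma> ^ 4 = \<alpha> ^ 4 * s\<^sup>2\<close>.\<close>
  have "csqrt (2 * s) ^ 4 = (csqrt (2 * s) ^ 2) ^ 2" by (subst power_mult[symmetric]) simp
  also have "\<dots> = 4 * s\<^sup>2" unfolding power2_csqrt by (simp add: power_mult_distrib)
  finally have "4 * \<gamma> ^ 4 = \<alpha> ^ 4 * s\<^sup>2"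
    unfolding assms(7) by (simp add: power_mult_distrib power_divide)
  then have g4: "4 * \<gamma> ^ 4 * EI_damped B s = of_real (rho B) * s\<^sup>2"
    using assms(5,6) by simp
  have "rho B \<noteq> 0" using assms(1) by (auto simp: valid_beam_def)
  \<comment> \<open>If \<gamma> vanished, the identity for its fourth power would make
    \<open>rho B\<close> times the square of \<open>s\<close> vanish as well.\<close>
  then have "\<gamma> \<noteq> 0" using g4 assms(4) by auto
  interpret transformed_beam B k \<psi>2 s \<gamma>
  proof
    show "\<psi>2 j absolutely_integrable_on {0..len B}" if "j \<in> {1..k}" for j
      using assms(2) that integrable_second_derivative_absolutely_integrable by blast
  qed fact+
  note out = transformed_system_output[OF _ assms(8)]
  have "transfer_matrix B k \<psi>2 p loc s H"
    unfolding transfer_matrix_def H_def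
    using transformed_system_exists[OF assms(8)] out assms(3) by blast
  moreover have "laplace_exists (y i) s \<and> laplace (y i) s = (\<Sum>j=0..k. H i j * laplace (u j) s)"
    if sys: "control_system B k \<psi>2 p loc u y D V A" and adm: "laplace_admissible B k s u D V A"
      and i: "i \<in> {1..p}" for u y D V A i
  proof -
    obtain W where W: "transformed_system B k \<psi>2 s (\<lambda>j. laplace (u j) s) W"
      "\<And>x. x \<in> {0..len B} \<Longrightarrow> laplace_exists (D 2 x) s \<and> W 2 x = laplace (D 2 x) s"
      using control_system_imp_transformed_system[OF assms(1,5) sys adm] by blast
    have loc: "loc i \<in> {0..len B}" using assms(3) i by blast
    have yD: "y i t = D 2 (loc i) t" if "t \<ge> 0" for t
      using sys i that unfolding control_system_def by blast
    have "laplace_exists (y i) s"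
      using laplace_exists_cong[of "D 2 (loc i)" "y i" s] yD W(2)[OF loc] by simp
    moreover have "laplace (y i) s = W 2 (loc i)"
      using laplace_cong[of "y i" "D 2 (loc i)" s] yD W(2)[OF loc] by simp
    ultimately show ?thesis using out[OF W(1) loc] by (simp add: H_def)
  qed
  ultimately show ?thesis by blast
qed

end
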